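(* Let $\Pi_1,\Pi_2$ be hereditary graph classes whose associated forbidden families $\mathcal F_1,\mathcal F_2$ are both finite, and suppose that for a fixed integer $\alpha$ the path $P_\alpha$ on $\alpha$ vertices belongs to $\mathcal F_1$. For $i\in\{1,2\}$ let $d_i$ be the maximum number of vertices of a graph in $\mathcal F_i$, and let $d=d_1+d_2+\alpha-2$. Consider the problem: given an undirected graph $G$ and an integer $k$, is there a set $S\subseteq V(G)$ of at most $k$ vertices such that every connected component of $G-S$ is in $\Pi_1$ or in $\Pi_2$? This problem admits a polynomial-time $d$-approximation algorithm (for the minimization of $|S|$), and, parameterized by $k$, a kernel with $O(k^d)$ vertices.
   Context: All graphs are finite, simple and undirected. A graph class is hereditary if it is closed under taking induced subgraphs. For $i\in\{1,2\}$, the forbidden family $\mathcal F_i$ associated to $\Pi_i$ is a family of graphs such that a graph has all of its connected components in $\Pi_i$ if and only if it contains no member of $\mathcal F_i$ as an induced subgraph. It is assumed throughout that all graphs in $\mathcal F_1$ and $\mathcal F_2$ are connected. The families $\mathcal F_1,\mathcal F_2$ and $\alpha$ are fixed. A kernel is a polynomial-time procedure that maps an instance $(G,k)$ to an equivalent instance $(G',k')$ of the same problem with $k'$ and the size of $G'$ bounded by functions of $k$. A $d$-approximation algorithm outputs a feasible set $S$ of size at most $d$ times the minimum size of a feasible set. *)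

theory Defs
  imports "HOL-Library.Landau_Symbols" "HOL-Computational_Algebra.Polynomial"
begin

section \<open>Finite simple undirected graphs\<close>

text \<open>An undirected edge between u and v is stored as the two ordered pairs (u, v) and (v, u).
  Vertices are natural numbers; every finite graph is isomorphic to such a graph.\<close>

datatype graph = Graph (verts: "nat set") (edges: "nat rel")

definition simple_graph :: "graph \<Rightarrow> bool" where
  "simple_graph G \<longleftrightarrow>
     finite (verts G) \<and> edges G \<subseteq> verts G \<times> verts G \<and> sym (edges G) \<and> irrefl (edges G)"

definition isomorphic :: "graph \<Rightarrow> graph \<Rightarrow> bool" where
  "isomorphic G H \<longleftrightarrow>
     (\<exists>\<phi>. bij_betw \<phi> (verts G) (verts H) \<and>
          (\<forall>u\<in>verts G. \<forall>v\<in>verts G. (u, v) \<in> edges G \<longleftrightarrow> (\<phi> u, \<phi> v) \<in> edges H))"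

definition induced :: "graph \<Rightarrow> nat set \<Rightarrow> graph" where
  "induced G W = Graph (verts G \<inter> W) (edges G \<inter> W \<times> W)"

definition delete :: "graph \<Rightarrow> nat set \<Rightarrow> graph" where
  "delete G S = induced G (verts G - S)"

definition contains_induced :: "graph \<Rightarrow> graph \<Rightarrow> bool" where
  "contains_induced G H \<longleftrightarrow> (\<exists>W\<subseteq>verts G. isomorphic H (induced G W))"

definition connected_graph :: "graph \<Rightarrow> bool" where
  "connected_graph G \<longleftrightarrow>
     verts G \<noteq> {} \<and> (\<forall>u\<in>verts G. \<forall>v\<in>verts G. (u, v) \<in> (edges G)\<^sup>*)"

definition components :: "graph \<Rightarrow> graph set" where
  "components G = (\<lambda>v. induced G ((edges G)\<^sup>* `` {v})) ` verts G"

definition path_graph :: "nat \<Rightarrow> graph" where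
  "path_graph n = Graph {..<n} {(i, j). i < n \<and> j < n \<and> (j = Suc i \<or> i = Suc j)}"


section \<open>Graph classes and forbidden families\<close>

definition graph_class :: "graph set \<Rightarrow> bool" where
  "graph_class \<Pi> \<longleftrightarrow>
     (\<forall>G\<in>\<Pi>. simple_graph G) \<and>
     (\<forall>G\<in>\<Pi>. \<forall>H. simple_graph H \<and> isomorphic G H \<longrightarrow> H \<in> \<Pi>)"

definition hereditary :: "graph set \<Rightarrow> bool" where
  "hereditary \<Pi> \<longleftrightarrow> (\<forall>G\<in>\<Pi>. \<forall>W\<subseteq>verts G. induced G W \<in> \<Pi>)"

text \<open>A family need not be closed under isomorphism: it is a set of representatives, so that
  finiteness of the set is finiteness of the family up to isomorphism.\<close>

definition forbidden_family :: "graph set \<Rightarrow> graph set \<Rightarrow> bool" where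
  "forbidden_family \<Pi> \<F> \<longleftrightarrow>
     (\<forall>H\<in>\<F>. simple_graph H) \<and>
     (\<forall>G. simple_graph G \<longrightarrow>
        ((\<forall>C\<in>components G. C \<in> \<Pi>) \<longleftrightarrow> (\<forall>H\<in>\<F>. \<not> contains_induced G H)))"

text \<open>The inserted 0 only matters for the empty family, whose maximum is read as 0.\<close>

definition max_order :: "graph set \<Rightarrow> nat" where
  "max_order \<F> = Max (insert 0 ((\<lambda>H. card (verts H)) ` \<F>))"


section \<open>Polynomial-time computation\<close>

text \<open>The machine model is the WHILE language over binary trees of N. D. Jones
  (Computability and Complexity from a Programming Perspective). The cost of evaluating an
  expression includes the sizes of all trees that are read, so the size of every computed value
  is bounded by the size of the input plus the running time, and programs and Turing machines
  simulate each other with polynomial overhead.\<close>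

datatype tree = Leaf | Node tree tree

datatype expr =
    Var nat
  | EmptyTree
  | Cons_expr expr expr
  | Left expr
  | Right expr
  | Equal expr expr

datatype com =
    Assign nat expr
  | Seq com com
  | Cond expr com com
  | While expr com

type_synonym store = "nat \<Rightarrow> tree"

fun left :: "tree \<Rightarrow> tree" where
  "left Leaf = Leaf"
| "left (Node l r) = l"

fun right :: "tree \<Rightarrow> tree" where
  "right Leaf = Leaf"
| "right (Node l r) = r"

text \<open>Truth values: \<^term>\<open>Leaf\<close> is false, every other tree counts as true.\<close>

fun enc_bool :: "bool \<Rightarrow> tree" where
  "enc_bool False = Leaf"
| "enc_bool True = Node Leaf Leaf"

fun eval_expr :: "expr \<Rightarrow> store \<Rightarrow> tree" where
  "eval_expr (Var x) s = s x"
| "eval_expr EmptyTree s = Leaf"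
| "eval_expr (Cons_expr a b) s = Node (eval_expr a s) (eval_expr b s)"
| "eval_expr (Left a) s = left (eval_expr a s)"
| "eval_expr (Right a) s = right (eval_expr a s)"
| "eval_expr (Equal a b) s = enc_bool (eval_expr a s = eval_expr b s)"

text \<open>The function \<^const>\<open>size\<close> generated by the datatype package counts the nodes other than
  leaves.\<close>

fun cost_expr :: "expr \<Rightarrow> store \<Rightarrow> nat" where
  "cost_expr (Var x) s = Suc (size (s x))"
| "cost_expr EmptyTree s = 1"
| "cost_expr (Cons_expr a b) s = Suc (cost_expr a s + cost_expr b s)"
| "cost_expr (Left a) s = Suc (cost_expr a s)"
| "cost_expr (Right a) s = Suc (cost_expr a s)"
| "cost_expr (Equal a b) s = Suc (cost_expr a s + cost_expr b s)"

text \<open>\<open>exec c s t s'\<close>: started in store s, the program c halts in store s' after time t.\<close>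

inductive exec :: "com \<Rightarrow> store \<Rightarrow> nat \<Rightarrow> store \<Rightarrow> bool" where
  Assign: "exec (Assign x e) s (Suc (cost_expr e s)) (s(x := eval_expr e s))"
| Seq: "exec c1 s t1 s1 \<Longrightarrow> exec c2 s1 t2 s2 \<Longrightarrow> exec (Seq c1 c2) s (t1 + t2) s2"
| CondTrue: "eval_expr e s \<noteq> Leaf \<Longrightarrow> exec c1 s t s1 \<Longrightarrow>
    exec (Cond e c1 c2) s (Suc (cost_expr e s + t)) s1"
| CondFalse: "eval_expr e s = Leaf \<Longrightarrow> exec c2 s t s1 \<Longrightarrow>
    exec (Cond e c1 c2) s (Suc (cost_expr e s + t)) s1"
| WhileFalse: "eval_expr e s = Leaf \<Longrightarrow> exec (While e c) s (Suc (cost_expr e s)) s"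
| WhileTrue: "eval_expr e s \<noteq> Leaf \<Longrightarrow> exec c s t1 s1 \<Longrightarrow> exec (While e c) s1 t2 s2 \<Longrightarrow>
    exec (While e c) s (Suc (cost_expr e s + t1 + t2)) s2"

text \<open>Variable 0 carries the input and the output; all other variables start as
  \<^term>\<open>Leaf\<close>.\<close>

definition init_store :: "tree \<Rightarrow> store" where
  "init_store x = (\<lambda>_. Leaf)(0 := x)"

definition polytime_computable ::
    "'a set \<Rightarrow> ('a \<Rightarrow> tree) \<Rightarrow> ('b \<Rightarrow> tree) \<Rightarrow> ('a \<Rightarrow> 'b) \<Rightarrow> bool" where
  "polytime_computable D enc_in enc_out f \<longleftrightarrow>
     (\<exists>(c :: com) (p :: nat poly). \<forall>x\<in>D. \<exists>t s.
        exec c (init_store (enc_in x)) t s \<and>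
        s 0 = enc_out (f x) \<and>
        t \<le> poly p (size (enc_in x)))"


section \<open>Encodings\<close>

fun enc_nat :: "nat \<Rightarrow> tree" where
  "enc_nat 0 = Leaf"
| "enc_nat (Suc n) = Node Leaf (enc_nat n)"

fun enc_list :: "('a \<Rightarrow> tree) \<Rightarrow> 'a list \<Rightarrow> tree" where
  "enc_list e [] = Leaf"
| "enc_list e (x # xs) = Node (e x) (enc_list e xs)"

definition enc_set :: "nat set \<Rightarrow> tree" where
  "enc_set S = enc_list enc_nat (sorted_list_of_set S)"

text \<open>Input and output graphs of algorithms have vertex set \<open>{0, ..., n - 1}\<close> and are given by
  their adjacency matrix.\<close>

definition instance_graphs :: "graph set" where
  "instance_graphs = {G. simple_graph G \<and> verts G = {..<card (verts G)}}"

definition enc_graph :: "graph \<Rightarrow> tree" where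
  "enc_graph G =
     (let n = card (verts G)
      in enc_list (enc_list enc_bool)
           (map (\<lambda>u. map (\<lambda>v. (u, v) \<in> edges G) [0..<n]) [0..<n]))"

text \<open>As usual in parameterized complexity, the parameter is encoded in unary.\<close>

fun enc_instance :: "graph \<times> nat \<Rightarrow> tree" where
  "enc_instance (G, k) = Node (enc_graph G) (enc_nat k)"


section \<open>Approximation algorithms and kernels\<close>

definition approximation_algorithm ::
    "(graph \<Rightarrow> nat set \<Rightarrow> bool) \<Rightarrow> nat \<Rightarrow> (graph \<Rightarrow> nat set) \<Rightarrow> bool" where
  "approximation_algorithm feasible \<rho> A \<longleftrightarrow>
     polytime_computable instance_graphs enc_graph enc_set A \<and>
     (\<forall>G\<in>instance_graphs.
        feasible G (A G) \<and> card (A G) \<le> \<rho> * Min (card ` {S. feasible G S}))"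

definition kernelization ::
    "(graph \<Rightarrow> nat \<Rightarrow> bool) \<Rightarrow> (graph \<times> nat \<Rightarrow> graph \<times> nat) \<Rightarrow> bool" where
  "kernelization Q K \<longleftrightarrow>
     polytime_computable (instance_graphs \<times> UNIV) enc_instance enc_instance K \<and>
     (\<exists>h :: nat \<Rightarrow> nat. \<forall>G\<in>instance_graphs. \<forall>k. \<forall>G' k'. K (G, k) = (G', k') \<longrightarrow>
        G' \<in> instance_graphs \<and>
        (Q G k \<longleftrightarrow> Q G' k') \<and>
        k' \<le> h k \<and>
        card (verts G') + card (edges G') \<le> h k)"


section \<open>Deletion to a pair of scattered graph classes\<close>

definition deletion_set :: "graph set \<Rightarrow> graph set \<Rightarrow> graph \<Rightarrow> nat set \<Rightarrow> bool" where
  "deletion_set \<Pi>\<^sub>1 \<Pi>\<^sub>2 G S \<longleftrightarrow>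
     S \<subseteq> verts G \<and> (\<forall>C\<in>components (delete G S). C \<in> \<Pi>\<^sub>1 \<or> C \<in> \<Pi>\<^sub>2)"

definition deletion_problem :: "graph set \<Rightarrow> graph set \<Rightarrow> graph \<Rightarrow> nat \<Rightarrow> bool" where
  "deletion_problem \<Pi>\<^sub>1 \<Pi>\<^sub>2 G k \<longleftrightarrow> (\<exists>S. deletion_set \<Pi>\<^sub>1 \<Pi>\<^sub>2 G S \<and> card S \<le> k)"

end

theory Submission
  imports Defs
begin

text \<open>Call a vertex set \<open>W\<close> an obstruction if \<open>G[W]\<close> is connected and lies in neither class; a set
  is feasible iff it meets every obstruction. An obstruction contains a copy of some \<open>H\<^sub>1 \<in> \<F>\<^sub>1\<close> and
  a copy of some \<open>H\<^sub>2 \<in> \<F>\<^sub>2\<close>. A shortest path between the two copies is induced: if it has at least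
  \<open>\<alpha>\<close> vertices, its last \<open>\<alpha>\<close> vertices form a \<open>P\<^sub>\<alpha>\<close>, itself a copy of a member of \<open>\<F>\<^sub>1\<close>, that meets the
  copy of \<open>H\<^sub>2\<close>; otherwise the path together with both copies is small. So every obstruction contains
  one with at most \<open>d\<close> vertices and the problem is a \<open>d\<close>-hitting set problem on the \<open>d\<close>-tuples of
  vertices that span an obstruction. A maximal packing of disjoint tuples gives the approximation.
  For the kernel a tuple is kept only while, for every set \<open>I\<close> of positions, fewer than
  \<open>(dk + 1)\<^bsup>d - |I|\<^esup>\<close> kept tuples agree with it on \<open>I\<close>; the kernel is the subgraph induced by the
  kept tuples.

  Polynomial running time is obtained from closure properties of a class of functions on trees.
  Whether a tuple spans an obstruction depends only on finitely many equality and adjacency tests,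
  so no isomorphism test has to be programmed.\<close>

section \<open>Polynomial-time functions on trees\<close>

text \<open>One exponent replaces a polynomial. The base is at least 2, so constants and sums are
  absorbed by raising \<open>b\<close>, and no coefficients have to be tracked.\<close>

definition poly_bounded :: "(nat \<Rightarrow> nat) \<Rightarrow> bool" where
  "poly_bounded q \<longleftrightarrow> (\<exists>b. \<forall>n. q n \<le> (n + 2) ^ b)"

lemma poly_boundedE:
  assumes "poly_bounded q"
  obtains b where "\<And>n. q n \<le> (n + 2) ^ b"
  using assms unfolding poly_bounded_def by blast

lemma poly_bounded_const: "poly_bounded (\<lambda>_. c)"
proof -
  have "c \<le> (n + 2) ^ c" for n
    using less_exp[of c] power_mono[of 2 "n + 2" c] by simp
  then show ?thesis unfolding poly_bounded_def by blast
qed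

lemma poly_bounded_id: "poly_bounded (\<lambda>n. n)"
  unfolding poly_bounded_def by (rule exI[of _ 1]) simp

lemma poly_bounded_mult:
  assumes "poly_bounded f" "poly_bounded g"
  shows "poly_bounded (\<lambda>n. f n * g n)"
proof -
  obtain a b where "\<And>n. f n \<le> (n + 2) ^ a" "\<And>n. g n \<le> (n + 2) ^ b"
    using assms by (meson poly_boundedE)
  then have "f n * g n \<le> (n + 2) ^ (a + b)" for n
    unfolding power_add by (rule mult_le_mono)
  then show ?thesis unfolding poly_bounded_def by blast
qed

lemma poly_bounded_add:
  assumes "poly_bounded f" "poly_bounded g"
  shows "poly_bounded (\<lambda>n. f n + g n)"
proof -
  obtain a b where a: "\<And>n. f n \<le> (n + 2) ^ a" and b: "\<And>n. g n \<le> (n + 2) ^ b"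
    using assms by (meson poly_boundedE)
  have "f n + g n \<le> (n + 2) ^ Suc (a + b)" for n
  proof -
    have "(n + 2) ^ a \<le> (n + 2) ^ (a + b)" "(n + 2) ^ b \<le> (n + 2) ^ (a + b)"
      by (auto intro: power_increasing)
    then have "f n + g n \<le> 2 * (n + 2) ^ (a + b)"
      using a[of n] b[of n] by linarith
    also have "\<dots> \<le> (n + 2) ^ Suc (a + b)" by simp
    finally show ?thesis .
  qed
  then show ?thesis unfolding poly_bounded_def by blast
qed

lemma poly_bounded_power: "poly_bounded f \<Longrightarrow> poly_bounded (\<lambda>n. f n ^ b)"
  by (induction b) (auto intro: poly_bounded_mult poly_bounded_const)

lemma poly_bounded_Suc: "poly_bounded f \<Longrightarrow> poly_bounded (\<lambda>n. Suc (f n))"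
  using poly_bounded_add[OF poly_bounded_const[of 1]] by simp

lemmas poly_bounded_intros = poly_bounded_const poly_bounded_id poly_bounded_add
  poly_bounded_mult poly_bounded_power poly_bounded_Suc

section \<open>Programs as subroutines and their composition\<close>

text \<open>A program that needs its work variables \<open>1, ..., m - 1\<close> empty and clears them again can be
  used as a subroutine.\<close>

definition clean :: "nat \<Rightarrow> store \<Rightarrow> bool" where
  "clean m r \<longleftrightarrow> (\<forall>i. 0 < i \<and> i < m \<longrightarrow> r i = Leaf)"

lemma clean_mono: "clean n r \<Longrightarrow> m \<le> n \<Longrightarrow> clean m r"
  unfolding clean_def by auto

lemma clean_upd: "clean m r \<Longrightarrow> i = 0 \<or> m \<le> i \<Longrightarrow> clean m (r(i := x))"
  unfolding clean_def by auto

text \<open>The final store differs from the initial one in variable 0 only, so a caller may keep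
  data in any variable from \<open>m\<close> on. The bound covers the output as well as the time,
  because the output of one program is the input of the next.\<close>

definition ptime :: "(tree \<Rightarrow> tree) \<Rightarrow> bool" where
  "ptime f \<longleftrightarrow> (\<exists>c m b. 0 < m \<and> (\<forall>r. clean m r \<longrightarrow>
     (\<exists>t. exec c r t (r(0 := f (r 0))) \<and> t + size (f (r 0)) \<le> (size (r 0) + 2) ^ b)))"

lemma ptimeI:
  assumes "poly_bounded q" "0 < m"
    and "\<And>r. clean m r \<Longrightarrow> \<exists>t. exec c r t (r(0 := f (r 0))) \<and> t + size (f (r 0)) \<le> q (size (r 0))"
  shows "ptime f"
  using assms unfolding ptime_def poly_bounded_def by (meson le_trans)

lemma ptime_size:
  assumes "ptime f"
  obtains b where "\<And>x. size (f x) \<le> (size x + 2) ^ b"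
proof -
  obtain c m b where *: "\<And>r. clean m r \<Longrightarrow>
     (\<exists>t. exec c r t (r(0 := f (r 0))) \<and> t + size (f (r 0)) \<le> (size (r 0) + 2) ^ b)"
    using assms unfolding ptime_def by blast
  have "size (f x) \<le> (size x + 2) ^ b" for x
    using *[of "init_store x"] by (auto simp: init_store_def clean_def)
  then show ?thesis by (rule that)
qed

lemma exec_AssignI:
  "s' = s(x := eval_expr e s) \<Longrightarrow> t = Suc (cost_expr e s) \<Longrightarrow> exec (Assign x e) s t s'"
  by (simp add: exec.Assign)

lemma ptime_expr:
  assumes "\<And>r. eval_expr e r = f (r 0)"
    and "\<And>r. cost_expr e r + size (f (r 0)) \<le> q (size (r 0))" "poly_bounded q"
  shows "ptime f"
proof (rule ptimeI[where c = "Assign 0 e" and m = 1 and q = "\<lambda>n. Suc (q n)"])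
  show "\<exists>t. exec (Assign 0 e) r t (r(0 := f (r 0))) \<and> t + size (f (r 0)) \<le> Suc (q (size (r 0)))" for r
    using assms(1,2)[of r] by (intro exI[of _ "Suc (cost_expr e r)"]) (simp add: exec_AssignI)
qed (use assms in \<open>auto intro: poly_bounded_intros\<close>)

lemma size_left: "size (left t) \<le> size t" by (cases t) auto
lemma size_right: "size (right t) \<le> size t" by (cases t) auto

lemma ptime_id: "ptime (\<lambda>x. x)"
  by (rule ptime_expr[where e = "Var 0" and q = "\<lambda>n. Suc (n + n)"])
    (auto intro!: poly_bounded_intros)

lemma ptime_Leaf: "ptime (\<lambda>x. Leaf)"
  by (rule ptime_expr[where e = EmptyTree and q = "\<lambda>n. 2"])
    (auto intro!: poly_bounded_intros)

lemma ptime_left0: "ptime left"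
  by (rule ptime_expr[where e = "Left (Var 0)" and q = "\<lambda>n. 2 + n + n"])
    (auto intro!: poly_bounded_intros simp: size_left)

lemma ptime_right0: "ptime right"
  by (rule ptime_expr[where e = "Right (Var 0)" and q = "\<lambda>n. 2 + n + n"])
    (auto intro!: poly_bounded_intros simp: size_right)

lemma ptime_comp:
  assumes "ptime g" "ptime f"
  shows "ptime (\<lambda>x. g (f x))"
proof -
  obtain c1 m1 b1 where m1: "0 < m1" and 1: "\<And>r. clean m1 r \<Longrightarrow>
     (\<exists>t. exec c1 r t (r(0 := f (r 0))) \<and> t + size (f (r 0)) \<le> (size (r 0) + 2) ^ b1)"
    using assms(2) unfolding ptime_def by blast
  obtain c2 m2 b2 where m2: "0 < m2" and 2: "\<And>r. clean m2 r \<Longrightarrow>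
     (\<exists>t. exec c2 r t (r(0 := g (r 0))) \<and> t + size (g (r 0)) \<le> (size (r 0) + 2) ^ b2)"
    using assms(1) unfolding ptime_def by blast
  show ?thesis
  proof (rule ptimeI[where c = "Seq c1 c2" and m = "max m1 m2"
        and q = "\<lambda>n. (n + 2) ^ b1 + ((n + 2) ^ b1 + 2) ^ b2"])
    fix r assume r: "clean (max m1 m2) r"
    let ?x = "r 0"
    obtain t1 where t1: "exec c1 r t1 (r(0 := f ?x))"
        "t1 + size (f ?x) \<le> (size ?x + 2) ^ b1"
      using 1[of r] clean_mono[OF r] by auto
    have "clean m2 (r(0 := f ?x))" using clean_mono[OF r] by (auto intro: clean_upd)
    then obtain t2 where t2: "exec c2 (r(0 := f ?x)) t2 (r(0 := g (f ?x)))"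
        "t2 + size (g (f ?x)) \<le> (size (f ?x) + 2) ^ b2"
      using 2[of "r(0 := f ?x)"] by auto
    have "(size (f ?x) + 2) ^ b2 \<le> ((size ?x + 2) ^ b1 + 2) ^ b2"
      using t1(2) by (intro power_mono) auto
    then have "t1 + t2 + size (g (f ?x)) \<le> (size ?x + 2) ^ b1 + ((size ?x + 2) ^ b1 + 2) ^ b2"
      using t1(2) t2(2) by linarith
    then show "\<exists>t. exec (Seq c1 c2) r t (r(0 := g (f ?x))) \<and>
        t + size (g (f ?x)) \<le> (size ?x + 2) ^ b1 + ((size ?x + 2) ^ b1 + 2) ^ b2"
      using exec.Seq[OF t1(1) t2(1)] by blast
  qed (use m1 in \<open>auto intro!: poly_bounded_intros\<close>)
qed

lemmas ptime_left = ptime_comp[OF ptime_left0]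
lemmas ptime_right = ptime_comp[OF ptime_right0]

lemma ptime_Node:
  assumes "ptime f" "ptime g"
  shows "ptime (\<lambda>x. Node (f x) (g x))"
proof -
  obtain c1 m1 b1 where m1: "0 < m1" and 1: "\<And>r. clean m1 r \<Longrightarrow>
     (\<exists>t. exec c1 r t (r(0 := f (r 0))) \<and> t + size (f (r 0)) \<le> (size (r 0) + 2) ^ b1)"
    using assms(1) unfolding ptime_def by blast
  obtain c2 m2 b2 where m2: "0 < m2" and 2: "\<And>r. clean m2 r \<Longrightarrow>
     (\<exists>t. exec c2 r t (r(0 := g (r 0))) \<and> t + size (g (r 0)) \<le> (size (r 0) + 2) ^ b2)"
    using assms(2) unfolding ptime_def by blast
  define m where "m = max m1 m2"
  \<comment> \<open>Variable \<open>m\<close> saves the input and \<open>Suc m\<close> the first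
    result; both lie beyond the work variables of \<open>c1\<close> and \<open>c2\<close>. The last
    two assignments restore the clean state.\<close>
  define c where "c = Seq (Assign m (Var 0)) (Seq c1 (Seq (Assign (Suc m) (Var 0)) (Seq (Assign 0 (Var m))
    (Seq c2 (Seq (Assign 0 (Cons_expr (Var (Suc m)) (Var 0))) (Seq (Assign m EmptyTree) (Assign (Suc m) EmptyTree)))))))"
  show ?thesis
  proof (rule ptimeI[where c = c and m = "m + 2"
        and q = "\<lambda>n. 20 + n + n + 3 * (n + 2) ^ b1 + 3 * (n + 2) ^ b2"])
    fix r assume r: "clean (m + 2) r"
    let ?x = "r 0"
    have m0: "0 < m" using m1 by (simp add: m_def)
    have rm: "clean m1 r" "clean m2 r" "r m = Leaf" "r (Suc m) = Leaf"
      using r m0 clean_mono[OF r, of m1] clean_mono[OF r, of m2]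
      by (auto simp: clean_def m_def[symmetric]) (auto simp: m_def)
    define r1 where "r1 = r(m := ?x)"
    have r10: "r1 0 = ?x" using m0 by (simp add: r1_def)
    have "clean m1 r1" using rm(1) unfolding r1_def m_def by (intro clean_upd) auto
    then obtain t1 where t1: "exec c1 r1 t1 (r1(0 := f ?x))"
        "t1 + size (f ?x) \<le> (size ?x + 2) ^ b1"
      using 1[of r1] r10 by auto
    define r3 where "r3 = r1(0 := f ?x, Suc m := f ?x, 0 := ?x)"
    have "clean m2 r3" using rm(2) unfolding r3_def r1_def m_def by (intro clean_upd) auto
    moreover have "r3 0 = ?x" by (simp add: r3_def)
    ultimately obtain t2 where t2: "exec c2 r3 t2 (r3(0 := g ?x))"
        "t2 + size (g ?x) \<le> (size ?x + 2) ^ b2"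
      using 2[of r3] by auto
    have fin: "r(0 := Node (f ?x) (g ?x)) =
      (r3(0 := g ?x))(0 := Node (f ?x) (g ?x), m := Leaf, Suc m := Leaf)"
      using rm m0 unfolding r3_def r1_def by (intro ext) auto
    have ex: "exec c r ((2 + size ?x) + (t1 + ((2 + size (f ?x)) + ((2 + size ?x) + (t2 +
      ((4 + size (f ?x) + size (g ?x)) + (2 + 2))))))) (r(0 := Node (f ?x) (g ?x)))"
      unfolding c_def fin
      apply (rule exec.Seq[where ?s1.0 = r1])
       apply (rule exec_AssignI; simp add: r1_def)
      apply (rule exec.Seq[OF t1(1)])
      apply (rule exec.Seq)
       apply (rule exec_AssignI; simp)
      apply (rule exec.Seq[where ?s1.0 = r3])
      using m0 apply (intro exec_AssignI; simp add: r3_def r1_def)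
      apply (rule exec.Seq[OF t2(1)])
      apply (rule exec.Seq)
      using m0 apply (intro exec_AssignI; simp add: r3_def r1_def)
      apply (rule exec.Seq)
      using m0 by (intro exec_AssignI; simp add: r3_def r1_def)+
    show "\<exists>t. exec c r t (r(0 := Node (f ?x) (g ?x))) \<and>
        t + size (Node (f ?x) (g ?x)) \<le> 20 + size ?x + size ?x + 3 * (size ?x + 2) ^ b1 + 3 * (size ?x + 2) ^ b2"
      by (intro exI conjI, rule ex) (use t1(2) t2(2) in simp)
  qed (auto intro!: poly_bounded_intros)
qed

lemma ptime_const: "ptime (\<lambda>x. t)"
  by (induction t) (auto intro: ptime_Leaf ptime_Node)

lemma size_enc_bool: "size (enc_bool b) \<le> 1" by (cases b) auto

lemma ptime_equal:
  assumes "ptime f" "ptime g"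
  shows "ptime (\<lambda>x. enc_bool (f x = g x))"
proof -
  have "ptime (\<lambda>x. enc_bool (left x = right x))"
    by (rule ptime_expr[where e = "Equal (Left (Var 0)) (Right (Var 0))" and q = "\<lambda>n. 6 + n + n"])
      (auto intro!: poly_bounded_intros intro: le_trans[OF size_enc_bool])
  from ptime_comp[OF this ptime_Node[OF assms]] show ?thesis by simp
qed

text \<open>Both branches are evaluated and packed into one tree together with the test; only then
  does the fixed program for \<open>h\<close> select. Branching thus reduces to composition with
  \<open>h\<close>.\<close>

lemma ptime_If:
  assumes "ptime (\<lambda>x. enc_bool (p x))" "ptime f" "ptime g"
  shows "ptime (\<lambda>x. if p x then f x else g x)"
proof -
  define h where "h x = (if left x \<noteq> Leaf then left (right x) else right (right x))" for x
  define c where "c = Cond (Left (Var 0)) (Assign 0 (Left (Right (Var 0)))) (Assign 0 (Right (Right (Var 0))))"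
  have "ptime h"
  proof (rule ptimeI[where c = c and m = 1 and q = "\<lambda>n. 10 + n + n + n"])
    fix r
    have "exec c r (Suc (Suc (Suc (size (r 0))) + (4 + size (r 0)))) (r(0 := h (r 0)))"
    proof -
      have 1: "exec (Assign 0 (Left (Right (Var 0)))) r (4 + size (r 0)) (r(0 := left (right (r 0))))"
        and 2: "exec (Assign 0 (Right (Right (Var 0)))) r (4 + size (r 0)) (r(0 := right (right (r 0))))"
        by (rule exec_AssignI; simp)+
      show ?thesis
        using exec.CondTrue[OF _ 1, of "Left (Var 0)"] exec.CondFalse[OF _ 2, of "Left (Var 0)"]
        by (cases "left (r 0) = Leaf") (simp_all add: h_def c_def)
    qed
    moreover have "size (h (r 0)) \<le> size (r 0)"
      unfolding h_def using size_left size_right by (auto intro: le_trans)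
    ultimately show "\<exists>t. exec c r t (r(0 := h (r 0))) \<and> t + size (h (r 0)) \<le> 10 + size (r 0) + size (r 0) + size (r 0)"
      by (intro exI conjI) auto
  qed (auto intro!: poly_bounded_intros)
  from ptime_comp[OF this ptime_Node[OF assms(1) ptime_Node[OF assms(2,3)]]]
  have "ptime (\<lambda>x. h (Node (enc_bool (p x)) (Node (f x) (g x))))" .
  moreover have "h (Node (enc_bool (p x)) (Node (f x) (g x))) = (if p x then f x else g x)" for x
    by (cases "p x") (auto simp: h_def)
  ultimately show ?thesis by simp
qed

section \<open>Trees as lists, loops and folds\<close>

text \<open>A tree is read as the list along its right spine. Every tree is such a list in exactly
  one way, so no well-formedness condition ever arises.\<close>

fun elems :: "tree \<Rightarrow> tree list" where
  "elems Leaf = []"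
| "elems (Node a b) = a # elems b"

abbreviation len :: "tree \<Rightarrow> nat" where
  "len t \<equiv> length (elems t)"

lemma len_le_size: "len t \<le> size t"
  by (induction t) auto

text \<open>The right spine of variable \<open>m\<close> serves as loop counter. The bound
  \<open>B\<close> on all intermediate values is essential: with polynomial time per round alone,
  the values could outgrow every polynomial.\<close>

lemma exec_While_iterate:
  assumes c: "\<And>r. clean m r \<Longrightarrow>
     (\<exists>t. exec c r t (r(0 := f (r 0))) \<and> t + size (f (r 0)) \<le> (size (r 0) + 2) ^ b)"
    and "0 < m" "clean m r"
    and "\<And>i. i \<le> len (r m) \<Longrightarrow> size ((f ^^ i) (r 0)) \<le> B" "size (r m) \<le> N"
  shows "\<exists>t. exec (While (Var m) (Seq c (Assign m (Right (Var m))))) r t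
     (r(0 := (f ^^ len (r m)) (r 0), m := Leaf)) \<and> t \<le> Suc (len (r m)) * ((B + 2) ^ b + 2 * N + 10)"
  using assms(3-)
proof (induction "r m" arbitrary: r)
  case Leaf
  have "r(0 := (f ^^ len (r m)) (r 0), m := Leaf) = r"
    using Leaf.hyps[symmetric] by auto
  then show ?case
    using exec.WhileFalse[of "Var m" r] Leaf.hyps[symmetric] by force
next
  case (Node a b')
  note rm = Node.hyps(3)[symmetric]
  obtain t1 where t1: "exec c r t1 (r(0 := f (r 0)))" "t1 + size (f (r 0)) \<le> (size (r 0) + 2) ^ b"
    using c[OF Node.prems(1)] by blast
  have "size (r 0) \<le> B" using Node.prems(2)[of 0] by simp
  then have t1B: "t1 \<le> (B + 2) ^ b"
    using t1(2) power_mono[of "size (r 0) + 2" "B + 2" b] by simp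
  define r2 where "r2 = r(0 := f (r 0), m := b')"
  have r2: "r2 m = b'" "r2 0 = f (r 0)" using assms(2) by (auto simp: r2_def)
  have ex2: "exec (Assign m (Right (Var m))) (r(0 := f (r 0))) (3 + size (r m)) r2"
    using assms(2) by (auto intro!: exec_AssignI simp: r2_def rm)
  have "\<exists>t. exec (While (Var m) (Seq c (Assign m (Right (Var m))))) r2 t
     (r2(0 := (f ^^ len (r2 m)) (r2 0), m := Leaf)) \<and> t \<le> Suc (len (r2 m)) * ((B + 2) ^ b + 2 * N + 10)"
  proof (rule Node.hyps(2))
    show "b' = r2 m" using r2 by simp
    show "clean m r2" unfolding r2_def using Node.prems(1) by (intro clean_upd) auto
    show "size ((f ^^ i) (r2 0)) \<le> B" if "i \<le> len (r2 m)" for i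
      using Node.prems(2)[of "Suc i"] that r2 rm by (simp add: funpow_swap1)
    show "size (r2 m) \<le> N" using Node.prems(3) r2 rm by simp
  qed
  then obtain t2 where t2: "exec (While (Var m) (Seq c (Assign m (Right (Var m))))) r2 t2
     (r2(0 := (f ^^ len (r2 m)) (r2 0), m := Leaf))" "t2 \<le> Suc (len (r2 m)) * ((B + 2) ^ b + 2 * N + 10)"
    by blast
  have fin: "r2(0 := (f ^^ len (r2 m)) (r2 0), m := Leaf) = r(0 := (f ^^ len (r m)) (r 0), m := Leaf)"
    using r2 rm by (auto simp: r2_def funpow_swap1)
  have "exec (While (Var m) (Seq c (Assign m (Right (Var m))))) r
     (Suc (cost_expr (Var m) r + (t1 + (3 + size (r m))) + t2)) (r(0 := (f ^^ len (r m)) (r 0), m := Leaf))"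
    using exec.WhileTrue[OF _ exec.Seq[OF t1(1) ex2] t2(1)] rm fin by simp
  moreover have "Suc (cost_expr (Var m) r + (t1 + (3 + size (r m))) + t2)
      \<le> Suc (len (r m)) * ((B + 2) ^ b + 2 * N + 10)"
    using t1B t2(2) Node.prems(3) rm r2 by simp
  ultimately show ?case by blast
qed

lemma ptime_iterate:
  assumes "ptime f" "ptime l" "ptime a" "poly_bounded q"
    and bound: "\<And>x i. i \<le> len (l x) \<Longrightarrow> size ((f ^^ i) (a x)) \<le> q (size x)"
  shows "ptime (\<lambda>x. (f ^^ len (l x)) (a x))"
proof -
  obtain c m b where m: "0 < m" and c: "\<And>r. clean m r \<Longrightarrow>
     (\<exists>t. exec c r t (r(0 := f (r 0))) \<and> t + size (f (r 0)) \<le> (size (r 0) + 2) ^ b)"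
    using assms(1) unfolding ptime_def by blast
  obtain c' m' b' where m': "0 < m'" and c': "\<And>r. clean m' r \<Longrightarrow>
     (\<exists>t. exec c' r t (r(0 := Node (l (r 0)) (a (r 0)))) \<and>
        t + size (Node (l (r 0)) (a (r 0))) \<le> (size (r 0) + 2) ^ b')"
    using ptime_Node[OF assms(2,3)] unfolding ptime_def by blast
  define n where "n = max m m'"
  define w where "w = While (Var n) (Seq c (Assign n (Right (Var n))))"
  \<comment> \<open>Counter and start value both depend on the input in variable 0, so they are
    computed together as one pair and unpacked afterwards.\<close>
  define d where "d = Seq c' (Seq (Assign n (Left (Var 0))) (Seq (Assign 0 (Right (Var 0))) w))"
  define Q where "Q i = (let p = (i + 2) ^ b' in 10 + 4 * p + q i + Suc p * ((q i + 2) ^ b + 2 * p + 10))" for i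
  show ?thesis
  proof (rule ptimeI[where c = d and m = "Suc n" and q = Q])
    fix r assume r: "clean (Suc n) r"
    let ?x = "r 0"
    define p where "p = (size ?x + 2) ^ b'"
    have "clean m' r" using clean_mono[OF r, of m'] by (simp add: n_def)
    then obtain t' where t': "exec c' r t' (r(0 := Node (l ?x) (a ?x)))"
        "t' + size (Node (l ?x) (a ?x)) \<le> p"
      using c' unfolding p_def by blast
    define r2 where "r2 = r(0 := Node (l ?x) (a ?x), n := l ?x, 0 := a ?x)"
    have n0: "0 < n" using m by (simp add: n_def)
    then have r2: "r2 n = l ?x" "r2 0 = a ?x" by (auto simp: r2_def)
    have lx: "len (l ?x) \<le> p" "size (l ?x) \<le> p" using t'(2) len_le_size[of "l ?x"] by auto
    have "clean n r2" unfolding r2_def using clean_mono[OF r] by (intro clean_upd) auto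
    then have "\<exists>t. exec w r2 t (r2(0 := (f ^^ len (r2 n)) (r2 0), n := Leaf)) \<and>
        t \<le> Suc (len (r2 n)) * ((q (size ?x) + 2) ^ b + 2 * p + 10)"
      unfolding w_def
    proof (rule exec_While_iterate[rotated 2])
      show "\<exists>t. exec c s t (s(0 := f (s 0))) \<and> t + size (f (s 0)) \<le> (size (s 0) + 2) ^ b"
        if "clean n s" for s
        using c[OF clean_mono[OF that]] by (simp add: n_def)
      show "size ((f ^^ i) (r2 0)) \<le> q (size ?x)" if "i \<le> len (r2 n)" for i
        using bound that r2 by simp
    qed (use n0 lx r2 in auto)
    then obtain t where t: "exec w r2 t (r2(0 := (f ^^ len (r2 n)) (r2 0), n := Leaf))"
      "t \<le> Suc (len (r2 n)) * ((q (size ?x) + 2) ^ b + 2 * p + 10)" by blast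
    have fin: "r2(0 := (f ^^ len (r2 n)) (r2 0), n := Leaf) = r(0 := (f ^^ len (l ?x)) (a ?x))"
      using r n0 r2 by (auto simp: r2_def clean_def)
    have ex: "exec d r (t' + ((4 + size (l ?x) + size (a ?x)) + ((4 + size (l ?x) + size (a ?x)) + t)))
        (r(0 := (f ^^ len (l ?x)) (a ?x)))"
      unfolding d_def
      apply (rule exec.Seq[OF t'(1)])
      apply (rule exec.Seq)
       apply (rule exec_AssignI; simp)
      apply (rule exec.Seq[where ?s1.0 = r2])
      using n0 apply (intro exec_AssignI; simp add: r2_def)
      using t(1) fin by simp
    have "Suc (len (l ?x)) * ((q (size ?x) + 2) ^ b + 2 * p + 10)
        \<le> Suc p * ((q (size ?x) + 2) ^ b + 2 * p + 10)"
      using lx by (intro mult_le_mono1) simp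
    then have "t \<le> Suc p * ((q (size ?x) + 2) ^ b + 2 * p + 10)"
      using t(2) unfolding r2 by linarith
    moreover have "size ((f ^^ len (l ?x)) (a ?x)) \<le> q (size ?x)" by (simp add: bound)
    moreover have "t' + size (l ?x) + size (a ?x) \<le> p" using t'(2) by simp
    ultimately have "t' + ((4 + size (l ?x) + size (a ?x)) + ((4 + size (l ?x) + size (a ?x)) + t))
        + size ((f ^^ len (l ?x)) (a ?x)) \<le> Q (size ?x)"
      unfolding Q_def Let_def p_def[symmetric] by linarith
    then show "\<exists>t. exec d r t (r(0 := (f ^^ len (l ?x)) (a ?x))) \<and>
      t + size ((f ^^ len (l ?x)) (a ?x)) \<le> Q (size ?x)"
      using ex by blast
  next
    have "poly_bounded (\<lambda>i. 10 + 4 * (i + 2) ^ b' + q i +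
        Suc ((i + 2) ^ b') * ((q i + 2) ^ b + 2 * (i + 2) ^ b' + 10))"
      by (intro poly_bounded_intros assms(4))
    then show "poly_bounded Q" unfolding Q_def Let_def .
  qed simp
qed

abbreviation enc :: "tree list \<Rightarrow> tree" where
  "enc \<equiv> enc_list (\<lambda>t. t)"

lemma elems_enc_list [simp]: "elems (enc_list e xs) = map e xs"
  by (induction xs) auto

lemma enc_elems [simp]: "enc (elems t) = t"
  by (induction t) auto

lemma enc_map: "enc (map e xs) = enc_list e xs"
  by (induction xs) auto

lemma size_enc: "size (enc ts) = (\<Sum>t\<leftarrow>ts. Suc (size t))"
  by (induction ts) auto

lemma size_elems: "size t = (\<Sum>u\<leftarrow>elems t. Suc (size u))"
  by (induction t) auto

lemma size_mem_enc: "t \<in> set ts \<Longrightarrow> size t \<le> size (enc ts)"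
  by (induction ts) auto

lemma enc_eq_Leaf: "enc ts = Leaf \<longleftrightarrow> ts = []"
  by (cases ts) auto

lemma right_enc: "(right ^^ i) (enc ts) = enc (drop i ts)"
proof (induction i arbitrary: ts)
  case (Suc i)
  then show ?case using Suc.IH[of "[]"] by (cases ts) (auto simp: funpow_swap1)
qed simp

lemma ptime_elems: "ptime l \<Longrightarrow> ptime (\<lambda>x. enc (elems (l x)))"
  by simp

lemma ptime_Cons: "ptime f \<Longrightarrow> ptime (\<lambda>x. enc (L x)) \<Longrightarrow> ptime (\<lambda>x. enc (f x # L x))"
  by (simp add: ptime_Node)

lemma ptime_subst: "ptime (\<lambda>x. enc (L x)) \<Longrightarrow> ptime f \<Longrightarrow> ptime (\<lambda>x. enc (L (f x)))"
  by (rule ptime_comp)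

text \<open>The argument of a fold step is packed as \<open>Node x (Node y acc)\<close>; this map
  forgets the accumulator.\<close>

lemma ptime_drop_acc: "ptime (\<lambda>z. Node (left z) (left (right z)))"
  by (intro ptime_Node ptime_left ptime_right ptime_id)

text \<open>Here the second component is the whole remaining list, and it is replaced by its
  head.\<close>

lemma ptime_drop_rest: "ptime (\<lambda>z. Node (left z) (Node (left (left (right z))) (right (right z))))"
  by (intro ptime_Node ptime_left ptime_right ptime_id)

text \<open>The fold is an iteration on states \<open>Node x (Node rest acc)\<close>. Carrying
  \<open>x\<close> along unchanged lets \<open>step\<close> depend on the input, which is how
  functions of several arguments are handled by the unary notion \<open>ptime\<close>.\<close>

lemma ptime_fold:
  assumes step: "ptime (\<lambda>z. step (left z) (left (right z)) (right (right z)))"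
    and L: "ptime (\<lambda>x. enc (L x))" and a: "ptime a" and q: "poly_bounded q"
    and bound: "\<And>x i. i \<le> length (L x) \<Longrightarrow> size (fold (step x) (take i (L x)) (a x)) \<le> q (size x)"
  shows "ptime (\<lambda>x. fold (step x) (L x) (a x))"
proof -
  define F where "F z = Node (left z) (Node (right (left (right z)))
      (step (left z) (left (left (right z))) (right (right z))))" for z
  have F: "(F ^^ i) (Node x (Node (enc ts) acc)) =
      Node x (Node (enc (drop i ts)) (fold (step x) (take i ts) acc))" if "i \<le> length ts" for i x ts acc
    using that
  proof (induction i arbitrary: ts acc)
    case (Suc i)
    then obtain t us where "ts = t # us" by (cases ts) auto
    moreover have "F (Node x (Node (enc (t # us)) acc)) = Node x (Node (enc us) (step x t acc))"
      by (simp add: F_def)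
    ultimately show ?case using Suc.prems Suc.IH[of us "step x t acc"]
      by (simp add: funpow_swap1 del: enc_list.simps)
  qed simp
  have "ptime F"
    unfolding F_def
    using ptime_comp[OF step ptime_drop_rest]
    by (auto intro!: ptime_Node ptime_left ptime_right ptime_id)
  obtain b where b: "\<And>x. size (enc (L x)) \<le> (size x + 2) ^ b"
    using ptime_size[OF L] by blast
  have "ptime (\<lambda>x. (F ^^ len (enc (L x))) (Node x (Node (enc (L x)) (a x))))"
  proof (rule ptime_iterate[where q = "\<lambda>n. Suc (n + Suc ((n + 2) ^ b + q n))"])
    fix x i assume "i \<le> len (enc (L x))"
    then have i: "i \<le> length (L x)" by simp
    have "size (enc (drop i (L x))) \<le> size (enc (L x))"
      unfolding size_enc by (metis append_take_drop_id le_add2 map_append sum_list_append)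
    then show "size ((F ^^ i) (Node x (Node (enc (L x)) (a x)))) \<le> Suc (size x + Suc ((size x + 2) ^ b + q (size x)))"
      using bound[OF i] b[of x] by (simp add: F[OF i])
  qed (use \<open>ptime F\<close> L a q in \<open>auto intro!: ptime_Node ptime_id poly_bounded_intros\<close>)
  from ptime_right[OF ptime_right[OF this]] show ?thesis
    by (simp add: F)
qed

text \<open>If a step enlarges the accumulator by an amount that does not depend on the accumulator,
  the sizes add up along the list and stay polynomial.\<close>

lemma ptime_fold_additive:
  assumes step: "ptime (\<lambda>z. step (left z) (left (right z)) (right (right z)))"
    and L: "ptime (\<lambda>x. enc (L x))" and a: "ptime a"
    and add: "\<And>x y s. size (step x y s) \<le> size s + (size x + size y + 2) ^ b"
  shows "ptime (\<lambda>x. fold (step x) (L x) (a x))"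
proof -
  obtain c where c: "\<And>x. size (enc (L x)) \<le> (size x + 2) ^ c"
    using ptime_size[OF L] by blast
  obtain e where e: "\<And>x. size (a x) \<le> (size x + 2) ^ e"
    using ptime_size[OF a] by blast
  have fold: "size (fold (step x) ts s) \<le> size s + length ts * (size x + N + 2) ^ b"
    if "\<And>t. t \<in> set ts \<Longrightarrow> size t \<le> N" for x ts s N
    using that
  proof (induction ts arbitrary: s)
    case (Cons t ts)
    have "(size x + size t + 2) ^ b \<le> (size x + N + 2) ^ b"
      using Cons.prems[of t] by (intro power_mono) auto
    then show ?case using Cons.IH[of "step x t s"] Cons.prems add[of x t s] by force
  qed simp
  show ?thesis
  proof (rule ptime_fold[where q = "\<lambda>n. (n + 2) ^ e + (n + 2) ^ c * (n + (n + 2) ^ c + 2) ^ b"])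
    fix x i assume i: "i \<le> length (L x)"
    have "size t \<le> size (enc (L x))" if "t \<in> set (L x)" for t
      using that by (rule size_mem_enc)
    then have "size (fold (step x) (take i (L x)) (a x))
        \<le> size (a x) + length (take i (L x)) * (size x + (size x + 2) ^ c + 2) ^ b"
      using c[of x] by (intro fold) (metis in_set_takeD le_trans)
    also have "length (take i (L x)) \<le> (size x + 2) ^ c"
      using i c[of x] len_le_size[of "enc (L x)"] by simp
    finally show "size (fold (step x) (take i (L x)) (a x))
        \<le> (size x + 2) ^ e + (size x + 2) ^ c * (size x + (size x + 2) ^ c + 2) ^ b"
      using e[of x] by (simp add: add_mono)
  qed (use assms in \<open>auto intro!: poly_bounded_intros\<close>)
qed

lemma fold_Node: "fold (\<lambda>y. Node (f y)) ts (enc us) = enc (rev (map f ts) @ us)"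
proof (induction ts arbitrary: us)
  case (Cons t ts)
  show ?case using Cons.IH[of "f t # us"] by simp
qed simp

lemma ptime_rev:
  assumes "ptime (\<lambda>x. enc (L x))"
  shows "ptime (\<lambda>x. enc (rev (L x)))"
proof -
  have "ptime (\<lambda>x. fold (\<lambda>y. Node y) (L x) Leaf)"
    using assms by (intro ptime_fold_additive[where b = 1])
      (auto intro!: ptime_Node ptime_left ptime_right ptime_id ptime_Leaf)
  then show ?thesis using fold_Node[of "\<lambda>y. y" _ "[]"] by simp
qed

lemma ptime_map:
  assumes f: "ptime (\<lambda>z. f (left z) (right z))" and L: "ptime (\<lambda>x. enc (L x))"
  shows "ptime (\<lambda>x. enc (map (f x) (L x)))"
proof -
  obtain b where b: "\<And>x. size (f (left x) (right x)) \<le> (size x + 2) ^ b"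
    using ptime_size[OF f] by blast
  have "ptime (\<lambda>x. fold (\<lambda>y. Node (f x y)) (L x) Leaf)"
  \<comment> \<open>The argument \<open>Node x y\<close> yields the base
    \<open>size x + size y + 3\<close>, which is at most the square of
    \<open>size x + size y + 2\<close>; this doubles the exponent. One more factor pays for the new
    \<open>Node\<close>.\<close>
  proof (rule ptime_fold_additive[where b = "Suc (2 * b)"])
    show "ptime (\<lambda>z. Node (f (left z) (left (right z))) (right (right z)))"
      using ptime_comp[OF f ptime_drop_acc]
      by (auto intro!: ptime_Node ptime_left ptime_right ptime_id)
    fix x y s
    have 1: "size (f x y) \<le> (size x + size y + 3) ^ b" using b[of "Node x y"] by (simp add: numeral_eq_Suc)
    have "size x + size y + 3 \<le> (size x + size y + 2)\<^sup>2"
      by (simp add: power2_eq_square algebra_simps)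
    then have "(size x + size y + 3) ^ b \<le> (size x + size y + 2) ^ (2 * b)"
      unfolding power_mult by (intro power_mono) auto
    then have "Suc (size (f x y)) \<le> 2 * (size x + size y + 2) ^ (2 * b)"
      using 1 one_le_power[of "size x + size y + 2" "2 * b"] by linarith
    also have "\<dots> \<le> (size x + size y + 2) ^ Suc (2 * b)"
      by simp
    finally show "size (Node (f x y) s) \<le> size s + (size x + size y + 2) ^ Suc (2 * b)"
      by simp
  qed (use L in \<open>auto intro: ptime_Leaf\<close>)
  moreover have "fold (\<lambda>y. Node (f x y)) (L x) Leaf = enc (rev (map (f x) (L x)))" for x
    using fold_Node[of "f x" "L x" "[]"] by simp
  ultimately have "ptime (\<lambda>x. enc (rev (map (f x) (L x))))" by simp
  from ptime_rev[OF this] show ?thesis by simp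
qed

lemma ptime_append:
  assumes "ptime (\<lambda>x. enc (L x))" "ptime (\<lambda>x. enc (M x))"
  shows "ptime (\<lambda>x. enc (L x @ M x))"
proof -
  have "ptime (\<lambda>x. fold (\<lambda>y. Node y) (rev (L x)) (enc (M x)))"
    using assms by (intro ptime_fold_additive[where b = 1])
      (auto intro!: ptime_Node ptime_left ptime_right ptime_id ptime_Leaf ptime_rev)
  then show ?thesis using fold_Node[of "\<lambda>y. y"] by simp
qed

lemma ptime_concat:
  assumes "ptime (\<lambda>x. enc_list enc (L x))"
  shows "ptime (\<lambda>x. enc (concat (L x)))"
proof -
  have "ptime (\<lambda>x. fold (\<lambda>y s. enc (elems y @ elems s)) (rev (map enc (L x))) Leaf)"
  proof (rule ptime_fold_additive[where b = 1])
    show "size (enc (elems y @ elems s)) \<le> size s + (size x + size y + 2) ^ 1" for x y s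
      by (simp add: size_enc size_elems[of y] size_elems[of s])
  qed (use assms in \<open>auto intro!: ptime_append ptime_elems ptime_left ptime_right ptime_id ptime_Leaf ptime_rev
    simp only: enc_map\<close>)
  moreover have "fold (\<lambda>y s. enc (elems y @ elems s)) (rev (map enc LL)) Leaf = enc (concat LL)" for LL
    unfolding foldr_conv_fold[symmetric] by (induction LL) auto
  ultimately show ?thesis by simp
qed

text \<open>Accepted elements are prepended, so the elements against which any \<open>x\<close> was
  tested form a suffix of the final result. Packing and kernel are two instances with different
  tests.\<close>

definition greedy :: "('a \<Rightarrow> 'a list \<Rightarrow> bool) \<Rightarrow> 'a list \<Rightarrow> 'a list" where
  "greedy P xs = fold (\<lambda>x ys. if P x ys then x # ys else ys) xs []"

lemma ptime_greedy:
  assumes P: "ptime (\<lambda>z. enc_bool (P (left z) (left (right z)) (elems (right (right z)))))"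
    and L: "ptime (\<lambda>x. enc (L x))"
  shows "ptime (\<lambda>x. enc (greedy (P x) (L x)))"
proof -
  have "ptime (\<lambda>x. fold (\<lambda>y s. if P x y (elems s) then Node y s else s) (L x) Leaf)"
    using assms by (intro ptime_fold_additive[where b = 1])
      (auto intro!: ptime_If ptime_Node ptime_left ptime_right ptime_id ptime_Leaf)
  moreover have "fold (\<lambda>y s. if P x y (elems s) then Node y s else s) ts (enc us) =
      enc (fold (\<lambda>y ys. if P x y ys then y # ys else ys) ts us)" for x ts us
  proof (induction ts arbitrary: us)
    case (Cons t ts)
    show ?case using Cons.IH[of "t # us"] Cons.IH[of us] by simp
  qed simp
  from this[of _ _ "[]"] have "fold (\<lambda>y s. if P x y (elems s) then Node y s else s) ts Leaf =
      enc (greedy (P x) ts)" for x ts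
    by (simp add: greedy_def)
  ultimately show ?thesis by simp
qed

lemma ptime_filter:
  assumes P: "ptime (\<lambda>z. enc_bool (P (left z) (right z)))" and L: "ptime (\<lambda>x. enc (L x))"
  shows "ptime (\<lambda>x. enc (filter (P x) (L x)))"
proof -
  have "ptime (\<lambda>x. enc (rev (greedy (\<lambda>y ys. P x y) (L x))))"
    using ptime_comp[OF P ptime_drop_acc] L by (intro ptime_rev ptime_greedy) auto
  moreover have "rev (fold (\<lambda>y ys. if Q y then y # ys else ys) ts us) = rev us @ filter Q ts" for Q ts and us :: "tree list"
    by (induction ts arbitrary: us) auto
  ultimately show ?thesis by (simp add: greedy_def)
qed

text \<open>The length \<open>n\<close> is a constant of the program. The induction on it builds a
  new program for each \<open>n\<close>, and the degree of its time bound may grow with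
  \<open>n\<close>.\<close>

lemma ptime_n_lists:
  assumes "ptime (\<lambda>x. enc (L x))"
  shows "ptime (\<lambda>x. enc_list enc (List.n_lists n (L x)))"
proof (induction n)
  case 0
  show ?case by (simp add: ptime_const)
next
  case (Suc n)
  have "ptime (\<lambda>x. enc (map (\<lambda>y. Node y (right x)) (L (left x))))"
    using ptime_comp[OF assms ptime_left[OF ptime_id]]
    by (intro ptime_map[where f = "\<lambda>x y. Node y (right x)"]) (auto intro!: ptime_Node ptime_left ptime_right ptime_id)
  then have "ptime (\<lambda>x. enc (map (\<lambda>t. enc (map (\<lambda>y. Node y t) (L x))) (map enc (List.n_lists n (L x)))))"
    by (rule ptime_map[where f = "\<lambda>x t. enc (map (\<lambda>y. Node y t) (L x))"])
      (use Suc in \<open>simp_all add: enc_map\<close>)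
  moreover have "enc (map (\<lambda>t. enc (map (\<lambda>y. Node y t) (L x))) (map enc (List.n_lists n (L x)))) =
      enc_list enc (map (\<lambda>t. map (\<lambda>y. Node y t) (L x)) (map enc (List.n_lists n (L x))))" for x
    unfolding enc_map[of enc, symmetric] by (simp add: comp_def)
  ultimately have "ptime (\<lambda>x. enc (concat (map (\<lambda>t. map (\<lambda>y. Node y t) (L x)) (map enc (List.n_lists n (L x))))))"
    by (intro ptime_concat) simp
  moreover have "enc (concat (map (\<lambda>t. map (\<lambda>y. Node y t) (L x)) (map enc (List.n_lists n (L x))))) =
      enc_list enc (List.n_lists (Suc n) (L x))" for x
    unfolding enc_map[of enc, symmetric] by (simp add: map_concat comp_def)
  ultimately show ?case by simp
qed

lemma ptime_upt:
  assumes "ptime (\<lambda>x. enc (L x))"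
  shows "ptime (\<lambda>x. enc_list enc_nat [0..<length (L x)])"
proof -
  \<comment> \<open>The accumulator starts as the list containing only 0, and each step prepends the
    successor of its head. This yields one number too many, which the final \<open>right\<close>
    removes. The growth depends on the accumulator, so \<open>ptime_fold_additive\<close> does not
    apply.\<close>
  have fold: "fold (\<lambda>y s. Node (Node Leaf (left s)) s) ts (Node Leaf Leaf) = enc_list enc_nat (rev [0..<Suc (length ts)])"
    for ts :: "tree list"
    by (induction ts rule: rev_induct) auto
  have sz: "size (enc_list enc_nat (rev [0..<n])) \<le> n * n" for n
  proof (induction n)
    case (Suc n)
    have "size (enc_nat n) = n" by (induction n) auto
    then show ?case using Suc by simp
  qed simp
  obtain b where b: "\<And>x. size (enc (L x)) \<le> (size x + 2) ^ b"
    using ptime_size[OF assms] by blast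
  have "ptime (\<lambda>x. fold (\<lambda>y s. Node (Node Leaf (left s)) s) (L x) (Node Leaf Leaf))"
  proof (rule ptime_fold[where q = "\<lambda>n. Suc ((n + 2) ^ b) * Suc ((n + 2) ^ b)"])
    fix x i assume "i \<le> length (L x)"
    then have i: "i \<le> (size x + 2) ^ b" using b[of x] len_le_size[of "enc (L x)"] by simp
    have "size (fold (\<lambda>y s. Node (Node Leaf (left s)) s) (take i (L x)) (Node Leaf Leaf))
        \<le> Suc (length (take i (L x))) * Suc (length (take i (L x)))"
      unfolding fold by (rule sz)
    also have "\<dots> \<le> Suc ((size x + 2) ^ b) * Suc ((size x + 2) ^ b)"
      using i by (intro mult_le_mono) auto
    finally show "size (fold (\<lambda>y s. Node (Node Leaf (left s)) s) (take i (L x)) (Node Leaf Leaf))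
        \<le> Suc ((size x + 2) ^ b) * Suc ((size x + 2) ^ b)" .
  qed (use assms in \<open>auto intro!: ptime_Node ptime_left ptime_right ptime_id ptime_const poly_bounded_intros\<close>)
  then have "ptime (\<lambda>x. enc (rev (elems (right (enc_list enc_nat (rev [0..<Suc (length (L x))]))))))"
    unfolding fold by (intro ptime_rev ptime_elems ptime_right)
  then show ?thesis by (simp add: rev_map[symmetric] enc_map)
qed

lemma ptime_funpow_right:
  assumes "ptime (\<lambda>x. enc (L x))" "ptime t"
  shows "ptime (\<lambda>x. (right ^^ length (L x)) (t x))"
proof -
  obtain b where b: "\<And>x. size (t x) \<le> (size x + 2) ^ b"
    using ptime_size[OF assms(2)] by blast
  have "size ((right ^^ i) u) \<le> size u" for i u
    by (induction i) (auto intro: le_trans[OF size_right])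
  then have "ptime (\<lambda>x. (right ^^ len (enc (L x))) (t x))"
    using assms b by (intro ptime_iterate[where q = "\<lambda>n. (n + 2) ^ b"])
      (auto intro!: ptime_right0 poly_bounded_intros intro: le_trans)
  then show ?thesis by simp
qed

lemma ptime_nth:
  assumes "ptime t"
  shows "ptime (\<lambda>x. left ((right ^^ n) (t x)))"
proof (rule ptime_left)
  show "ptime (\<lambda>x. (right ^^ n) (t x))"
    by (induction n) (auto intro: assms ptime_right)
qed

section \<open>Polynomial-time predicates\<close>

lemma ptime_conj:
  assumes "ptime (\<lambda>x. enc_bool (P x))" "ptime (\<lambda>x. enc_bool (Q x))"
  shows "ptime (\<lambda>x. enc_bool (P x \<and> Q x))"
proof -
  have "ptime (\<lambda>x. if P x then enc_bool (Q x) else enc_bool False)"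
    by (intro ptime_If ptime_const assms)
  moreover have "(if P x then enc_bool (Q x) else enc_bool False) = enc_bool (P x \<and> Q x)" for x by simp
  ultimately show ?thesis by simp
qed

lemma ptime_not:
  assumes "ptime (\<lambda>x. enc_bool (P x))"
  shows "ptime (\<lambda>x. enc_bool (\<not> P x))"
proof -
  have "ptime (\<lambda>x. if P x then enc_bool False else enc_bool True)"
    by (intro ptime_If ptime_const assms)
  moreover have "(if P x then enc_bool False else enc_bool True) = enc_bool (\<not> P x)" for x by simp
  ultimately show ?thesis by simp
qed

lemma ptime_length_less:
  assumes "ptime (\<lambda>x. enc (L x))" "ptime (\<lambda>x. enc (M x))"
  shows "ptime (\<lambda>x. enc_bool (length (L x) < length (M x)))"
proof -
  have "ptime (\<lambda>x. enc_bool (\<not> (right ^^ length (L x)) (enc (M x)) = Leaf))"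
    by (intro ptime_not ptime_equal ptime_funpow_right assms ptime_const)
  moreover have "(right ^^ length (L x)) (enc (M x)) = Leaf \<longleftrightarrow> \<not> length (L x) < length (M x)" for x
    by (simp add: right_enc enc_eq_Leaf not_less)
  ultimately show ?thesis by simp
qed

text \<open>The property \<open>\<Phi>\<close> is arbitrary, however hard it may be to decide: the
  program is a decision tree over the finitely many tests in \<open>A\<close>, and the values of
  \<open>\<Phi>\<close> are constants at its leaves. The induction therefore generalizes over
  \<open>\<Phi>\<close>.\<close>

lemma ptime_finite_pattern:
  fixes \<Phi> :: "'a set \<Rightarrow> bool"
  assumes "finite A" "\<And>a. a \<in> A \<Longrightarrow> ptime (\<lambda>x. enc_bool (P a x))"
  shows "ptime (\<lambda>x. enc_bool (\<Phi> {a \<in> A. P a x}))"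
  using assms
proof (induction A arbitrary: \<Phi> rule: finite_induct)
  case empty
  show ?case by (simp add: ptime_const)
next
  case (insert b A)
  have *: "ptime (\<lambda>x. if P b x then enc_bool (\<Phi> (insert b {a \<in> A. P a x})) else enc_bool (\<Phi> {a \<in> A. P a x}))"
    using insert.prems insert.IH[of "\<lambda>S. \<Phi> (insert b S)"] insert.IH[of \<Phi>] by (intro ptime_If) auto
  have "{a \<in> insert b A. P a x} = (if P b x then insert b {a \<in> A. P a x} else {a \<in> A. P a x})" for x
    by auto
  then have eq: "enc_bool (\<Phi> {a \<in> insert b A. P a x}) = (if P b x then enc_bool (\<Phi> (insert b {a \<in> A. P a x})) else enc_bool (\<Phi> {a \<in> A. P a x}))" for x
    by presburger
  show ?case using * unfolding eq .
qed

lemma ptime_finite_ball: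
  assumes "finite A" "\<And>a. a \<in> A \<Longrightarrow> ptime (\<lambda>x. enc_bool (P a x))"
  shows "ptime (\<lambda>x. enc_bool (\<forall>a\<in>A. P a x))"
proof -
  have "(\<forall>a\<in>A. P a x) \<longleftrightarrow> {a \<in> A. P a x} = A" for x by auto
  then show ?thesis using ptime_finite_pattern[OF assms, where \<Phi> = "\<lambda>S. S = A"] by simp
qed

lemma ptime_bex:
  assumes "ptime (\<lambda>z. enc_bool (P (left z) (right z)))" "ptime (\<lambda>x. enc (L x))"
  shows "ptime (\<lambda>x. enc_bool (\<exists>y\<in>set (L x). P x y))"
proof -
  have "ptime (\<lambda>x. enc_bool (\<not> enc (filter (P x) (L x)) = Leaf))"
    by (intro ptime_not ptime_equal ptime_filter assms ptime_const)
  then show ?thesis by (simp add: enc_eq_Leaf filter_empty_conv)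
qed

lemma ptime_imp_polytime_computable:
  assumes "ptime F" "\<And>x. x \<in> D \<Longrightarrow> F (enc_in x) = enc_out (f x)"
  shows "polytime_computable D enc_in enc_out f"
proof -
  obtain c m b where c: "\<And>r. clean m r \<Longrightarrow>
     (\<exists>t. exec c r t (r(0 := F (r 0))) \<and> t + size (F (r 0)) \<le> (size (r 0) + 2) ^ b)"
    using assms(1) unfolding ptime_def by blast
  \<comment> \<open>The polynomial \<open>[:2, 1:]\<close> is x + 2, so its power evaluates to the
    bound in \<open>ptime\<close>.\<close>
  have "\<exists>t s. exec c (init_store (enc_in x)) t s \<and> s 0 = enc_out (f x) \<and>
      t \<le> poly ([:2, 1:] ^ b) (size (enc_in x))" if "x \<in> D" for x
  proof -
    have "clean m (init_store (enc_in x))" by (simp add: clean_def init_store_def)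
    from c[OF this] obtain t where "exec c (init_store (enc_in x)) t ((init_store (enc_in x))(0 := F (enc_in x)))"
      "t + size (F (enc_in x)) \<le> (size (enc_in x) + 2) ^ b" by (auto simp: init_store_def)
    then show ?thesis
      by (intro exI[of _ t] exI[of _ "(init_store (enc_in x))(0 := F (enc_in x))"])
        (simp add: assms(2)[OF that])
  qed
  then show ?thesis unfolding polytime_computable_def by blast
qed

section \<open>Small obstructions\<close>

lemma verts_induced [simp]: "verts (induced G W) = verts G \<inter> W"
  and edges_induced [simp]: "edges (induced G W) = edges G \<inter> W \<times> W"
  by (simp_all add: induced_def)

lemma induced_induced: "W \<subseteq> V \<Longrightarrow> induced (induced G V) W = induced G W"
  by (auto simp: induced_def)

lemma simple_graph_induced: "simple_graph G \<Longrightarrow> simple_graph (induced G W)"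
  by (auto simp: simple_graph_def sym_def irrefl_def)

lemma isomorphic_sym:
  assumes "isomorphic G H"
  shows "isomorphic H G"
proof -
  obtain f where f: "bij_betw f (verts G) (verts H)"
    and e: "\<And>u v. u \<in> verts G \<Longrightarrow> v \<in> verts G \<Longrightarrow> (u, v) \<in> edges G \<longleftrightarrow> (f u, f v) \<in> edges H"
    using assms unfolding isomorphic_def by blast
  let ?g = "inv_into (verts G) f"
  have g: "bij_betw ?g (verts H) (verts G)" using f by (rule bij_betw_inv_into)
  moreover have "(u, v) \<in> edges H \<longleftrightarrow> (?g u, ?g v) \<in> edges G" if "u \<in> verts H" "v \<in> verts H" for u v
    using e[of "?g u" "?g v"] that g f by (simp add: bij_betw_apply bij_betw_inv_into_right)
  ultimately show ?thesis unfolding isomorphic_def by blast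
qed

lemma isomorphic_trans:
  assumes "isomorphic G H" "isomorphic H K"
  shows "isomorphic G K"
proof -
  obtain f where f: "bij_betw f (verts G) (verts H)"
    "\<forall>u\<in>verts G. \<forall>v\<in>verts G. (u, v) \<in> edges G \<longleftrightarrow> (f u, f v) \<in> edges H"
    using assms(1) unfolding isomorphic_def by blast
  obtain g where g: "bij_betw g (verts H) (verts K)"
    "\<forall>u\<in>verts H. \<forall>v\<in>verts H. (u, v) \<in> edges H \<longleftrightarrow> (g u, g v) \<in> edges K"
    using assms(2) unfolding isomorphic_def by blast
  show ?thesis unfolding isomorphic_def
    using bij_betw_trans[OF f(1) g(1)] f g(2) by (intro exI[of _ "g \<circ> f"]) (auto simp: bij_betw_apply)
qed

lemma isomorphic_card: "isomorphic G H \<Longrightarrow> card (verts G) = card (verts H)"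
  unfolding isomorphic_def using bij_betw_same_card by blast

lemma isomorphic_induced:
  assumes "W \<subseteq> verts G" "f ` W \<subseteq> verts H" "inj_on f W"
    and "\<And>u v. u \<in> W \<Longrightarrow> v \<in> W \<Longrightarrow> (u, v) \<in> edges G \<longleftrightarrow> (f u, f v) \<in> edges H"
  shows "isomorphic (induced G W) (induced H (f ` W))"
  unfolding isomorphic_def using assms
  by (intro exI[of _ f]) (auto simp: bij_betw_def Int_absorb1)

lemma rtrancl_image:
  assumes "(u, v) \<in> R\<^sup>*" "\<And>x y. (x, y) \<in> R \<Longrightarrow> (f x, f y) \<in> T"
  shows "(f u, f v) \<in> T\<^sup>*"
  using assms(1) by induction (auto intro: rtrancl_into_rtrancl assms(2))

lemma connected_graph_image:
  assumes "connected_graph G" "f ` verts G = verts H"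
    and "\<And>u v. (u, v) \<in> edges G \<Longrightarrow> (f u, f v) \<in> edges H"
  shows "connected_graph H"
  unfolding connected_graph_def
proof (intro conjI ballI)
  show "verts H \<noteq> {}" using assms(1,2) by (auto simp: connected_graph_def)
  fix u v assume "u \<in> verts H" "v \<in> verts H"
  then obtain u' v' where "u = f u'" "v = f v'" "u' \<in> verts G" "v' \<in> verts G"
    using assms(2) by blast
  then show "(u, v) \<in> (edges H)\<^sup>*"
    using assms(1) rtrancl_image[of u' v' "edges G" f "edges H"] assms(3)
    by (simp add: connected_graph_def)
qed

lemma connected_isomorphic:
  assumes "connected_graph G" "isomorphic G H" "simple_graph G"
  shows "connected_graph H"
proof -
  obtain f where f: "bij_betw f (verts G) (verts H)"
    "\<forall>u\<in>verts G. \<forall>v\<in>verts G. (u, v) \<in> edges G \<longleftrightarrow> (f u, f v) \<in> edges H"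
    using assms(2) unfolding isomorphic_def by blast
  show ?thesis
    by (rule connected_graph_image[of G f]) (use f assms in \<open>auto simp: bij_betw_def simple_graph_def\<close>)
qed

lemma connected_induced_Un:
  assumes "connected_graph (induced G A)" "connected_graph (induced G B)" "verts G \<inter> A \<inter> B \<noteq> {}"
  shows "connected_graph (induced G (A \<union> B))"
proof -
  obtain x where x: "x \<in> verts G" "x \<in> A" "x \<in> B" using assms(3) by blast
  let ?R = "edges (induced G (A \<union> B))"
  have A: "(u, v) \<in> ?R\<^sup>*" if "u \<in> verts G" "v \<in> verts G" "u \<in> A" "v \<in> A" for u v
    using assms(1) that rtrancl_mono[of "edges (induced G A)" ?R] unfolding connected_graph_def by auto
  have B: "(u, v) \<in> ?R\<^sup>*" if "u \<in> verts G" "v \<in> verts G" "u \<in> B" "v \<in> B" for u v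
    using assms(2) that rtrancl_mono[of "edges (induced G B)" ?R] unfolding connected_graph_def by auto
  have "(u, x) \<in> ?R\<^sup>* \<and> (x, u) \<in> ?R\<^sup>*" if "u \<in> verts G" "u \<in> A \<union> B" for u
    using A B that x by blast
  then show ?thesis
    unfolding connected_graph_def using x by (auto intro: rtrancl_trans)
qed

lemma connected_walk:
  assumes "simple_graph G" "a \<le> b" "\<And>i. a \<le> i \<Longrightarrow> i < b \<Longrightarrow> (p i, p (Suc i)) \<in> edges G" "p a \<in> verts G"
  shows "connected_graph (induced G (p ` {a..b}))"
proof -
  let ?R = "edges (induced G (p ` {a..b}))"
  have *: "(p a, p i) \<in> ?R\<^sup>*" if "a \<le> i" "i \<le> b" for i
    using that
  proof (induction i rule: dec_induct)
    case (step i)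
    then have "(p i, p (Suc i)) \<in> ?R" using assms(3)[of i] by auto
    then show ?case using step by (meson Suc_leD rtrancl.rtrancl_into_rtrancl)
  qed simp
  have "sym ?R" using simple_graph_induced[OF assms(1)] unfolding simple_graph_def by blast
  then have "sym (?R\<^sup>*)" by (rule sym_rtrancl)
  then have "(p i, p j) \<in> ?R\<^sup>*" if "a \<le> i" "i \<le> b" "a \<le> j" "j \<le> b" for i j
    using *[of i] *[of j] that by (meson rtrancl_trans symD)
  then show ?thesis
    unfolding connected_graph_def using assms(2,4) by auto
qed

lemma components_connected:
  assumes "simple_graph G" "connected_graph G"
  shows "components G = {G}"
proof -
  have "induced G ((edges G)\<^sup>* `` {v}) = G" if "v \<in> verts G" for v
  proof -
    have "verts G \<subseteq> (edges G)\<^sup>* `` {v}" using assms(2) that by (auto simp: connected_graph_def)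
    then show ?thesis using assms(1) by (cases G) (auto simp: induced_def simple_graph_def)
  qed
  then show ?thesis using assms(2) unfolding components_def connected_graph_def by auto
qed

text \<open>The forbidden family characterizes graphs by their components, and a connected graph is
  its own single component.\<close>

lemma connected_in_class_iff:
  assumes "forbidden_family \<Pi> \<F>" "simple_graph C" "connected_graph C"
  shows "C \<in> \<Pi> \<longleftrightarrow> (\<forall>H\<in>\<F>. \<not> contains_induced C H)"
  using assms components_connected[OF assms(2,3)] unfolding forbidden_family_def by auto

lemma card_le_max_order: "finite \<F> \<Longrightarrow> H \<in> \<F> \<Longrightarrow> card (verts H) \<le> max_order \<F>"
  unfolding max_order_def by (intro Max_ge) auto

text \<open>Take a walk of minimum length from \<open>A\<close> to \<open>B\<close>; a shorter walk
  between two of its vertices could replace the segment between them. The last conclusion is later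
  used with \<open>m = 0\<close>, where it makes the vertices distinct, and with
  \<open>m = 1\<close>, where it excludes chords.\<close>

lemma shortest_path:
  assumes "(u, v) \<in> R\<^sup>*" "u \<in> A" "v \<in> B"
  obtains p :: "nat \<Rightarrow> 'a" and l where "p 0 \<in> A" "p l \<in> B"
    "\<And>i. i < l \<Longrightarrow> (p i, p (Suc i)) \<in> R"
    "\<And>i j m. i \<le> j \<Longrightarrow> j \<le> l \<Longrightarrow> (p i, p j) \<in> R ^^ m \<Longrightarrow> j - i \<le> m"
proof -
  define Q where "Q n \<longleftrightarrow> (\<exists>u\<in>A. \<exists>v\<in>B. (u, v) \<in> R ^^ n)" for n
  have "\<exists>n. Q n" using assms rtrancl_imp_relpow unfolding Q_def by blast
  define l where "l = (LEAST n. Q n)"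
  have "Q l" unfolding l_def using \<open>\<exists>n. Q n\<close> by (rule LeastI_ex)
  then obtain p where p: "p 0 \<in> A" "p l \<in> B" "\<And>i. i < l \<Longrightarrow> (p i, p (Suc i)) \<in> R"
    unfolding Q_def relpow_fun_conv by blast
  have walk: "(p i, p j) \<in> R ^^ (j - i)" if "i \<le> j" "j \<le> l" for i j
    unfolding relpow_fun_conv using that p(3) by (intro exI[of _ "\<lambda>k. p (i + k)"]) auto
  have "j - i \<le> m" if "i \<le> j" "j \<le> l" "(p i, p j) \<in> R ^^ m" for i j m
  proof -
    have "(p 0, p l) \<in> R ^^ (i + (m + (l - j)))"
      unfolding relpow_add using walk[of 0 i] walk[of j l] that by auto
    then have "Q (i + (m + (l - j)))" unfolding Q_def using p by blast
    then have "l \<le> i + (m + (l - j))" unfolding l_def by (rule Least_le)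
    then show ?thesis using that by linarith
  qed
  with p show ?thesis using that by blast
qed

section \<open>Obstructions and feasibility\<close>

definition obstruction :: "graph set \<Rightarrow> graph set \<Rightarrow> graph \<Rightarrow> nat set \<Rightarrow> bool" where
  "obstruction \<Pi>\<^sub>1 \<Pi>\<^sub>2 G W \<longleftrightarrow>
     W \<subseteq> verts G \<and> connected_graph (induced G W) \<and> induced G W \<notin> \<Pi>\<^sub>1 \<union> \<Pi>\<^sub>2"

text \<open>The map \<open>f\<close> is an embedding on \<open>W\<close> alone. It is applied to two
  tuples with the same pattern and, in both directions, between a graph and its kernel.\<close>

lemma obstruction_transfer:
  assumes "graph_class \<Pi>\<^sub>1" "graph_class \<Pi>\<^sub>2" "simple_graph G" "simple_graph H"
    and "inj_on f W" "f ` W \<subseteq> verts H"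
    and e: "\<And>u v. u \<in> W \<Longrightarrow> v \<in> W \<Longrightarrow> (u, v) \<in> edges G \<longleftrightarrow> (f u, f v) \<in> edges H"
    and W: "obstruction \<Pi>\<^sub>1 \<Pi>\<^sub>2 G W"
  shows "obstruction \<Pi>\<^sub>1 \<Pi>\<^sub>2 H (f ` W)"
proof -
  have WG: "W \<subseteq> verts G" using W by (simp add: obstruction_def)
  have iso: "isomorphic (induced G W) (induced H (f ` W))"
    using assms WG by (intro isomorphic_induced) auto
  have "induced G W \<in> \<Pi>\<^sub>1 \<union> \<Pi>\<^sub>2" if "induced H (f ` W) \<in> \<Pi>\<^sub>1 \<union> \<Pi>\<^sub>2"
    using that isomorphic_sym[OF iso] assms(1,2) simple_graph_induced[OF assms(3)]
    unfolding graph_class_def by blast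
  then show ?thesis
    using W assms(6) connected_isomorphic[OF _ iso] simple_graph_induced[OF assms(3)]
    unfolding obstruction_def by blast
qed

text \<open>A component of \<open>G - S\<close> outside both classes is itself an obstruction that
  avoids \<open>S\<close>. Conversely, an obstruction avoiding \<open>S\<close> is connected, so it
  lies in one component of \<open>G - S\<close>, and heredity keeps that component out of both
  classes.\<close>

lemma deletion_set_iff:
  assumes G: "simple_graph G" and her: "hereditary \<Pi>\<^sub>1" "hereditary \<Pi>\<^sub>2"
  shows "deletion_set \<Pi>\<^sub>1 \<Pi>\<^sub>2 G S \<longleftrightarrow>
    S \<subseteq> verts G \<and> (\<forall>W. obstruction \<Pi>\<^sub>1 \<Pi>\<^sub>2 G W \<longrightarrow> W \<inter> S \<noteq> {})"
proof (cases "S \<subseteq> verts G")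
  case True
  define D where "D = delete G S"
  have D: "D = induced G (verts G - S)" by (simp add: D_def delete_def)
  have sD: "simple_graph D" unfolding D using G by (rule simple_graph_induced)
  have vD: "verts D = verts G - S" by (auto simp: D)
  have iD: "induced D W = induced G W" if "W \<subseteq> verts D" for W
    using induced_induced[of W "verts G - S" G] that unfolding vD D[symmetric] .
  have reach: "(edges D)\<^sup>* `` {v} \<subseteq> verts D" if v: "v \<in> verts D" for v
  proof
    fix w assume "w \<in> (edges D)\<^sup>* `` {v}"
    then have "(v, w) \<in> (edges D)\<^sup>*" by simp
    then show "w \<in> verts D" by induction (use v sD in \<open>auto simp: simple_graph_def\<close>)
  qed
  have conn: "connected_graph (induced D ((edges D)\<^sup>* `` {v}))" if v: "v \<in> verts D" for v
  proof -
    let ?K = "(edges D)\<^sup>* `` {v}"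
    let ?R = "edges (induced D ?K)"
    have *: "(v, w) \<in> ?R\<^sup>*" if "(v, w) \<in> (edges D)\<^sup>*" for w
      using that
    proof induction
      case (step w x)
      then have "(w, x) \<in> ?R" by (auto intro: rtrancl_into_rtrancl)
      with step.IH show ?case by (rule rtrancl_into_rtrancl)
    qed simp
    have "sym (?R\<^sup>*)"
      using simple_graph_induced[OF sD] sym_rtrancl unfolding simple_graph_def by blast
    then have "(u, w) \<in> ?R\<^sup>*" if "u \<in> ?K" "w \<in> ?K" for u w
      using *[of u] *[of w] that by (meson Image_singleton_iff rtrancl_trans symD)
    then show ?thesis unfolding connected_graph_def using v by auto
  qed
  have "(\<forall>C\<in>components D. C \<in> \<Pi>\<^sub>1 \<or> C \<in> \<Pi>\<^sub>2) \<longleftrightarrow> (\<forall>W. obstruction \<Pi>\<^sub>1 \<Pi>\<^sub>2 G W \<longrightarrow> W \<inter> S \<noteq> {})"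
  proof (intro iffI allI impI ballI notI)
    fix W assume good: "\<forall>C\<in>components D. C \<in> \<Pi>\<^sub>1 \<or> C \<in> \<Pi>\<^sub>2"
      and W: "obstruction \<Pi>\<^sub>1 \<Pi>\<^sub>2 G W" and "W \<inter> S = {}"
    then have WD: "W \<subseteq> verts D" unfolding vD obstruction_def by auto
    have cW: "connected_graph (induced D W)" using W iD[OF WD] by (simp add: obstruction_def)
    then obtain v where v: "v \<in> W" "v \<in> verts D" by (auto simp: connected_graph_def)
    let ?K = "(edges D)\<^sup>* `` {v}"
    have "(v, w) \<in> (edges D)\<^sup>*" if "w \<in> W" for w
      using cW v that WD rtrancl_mono[of "edges (induced D W)" "edges D"]
      unfolding connected_graph_def by auto
    then have WK: "W \<subseteq> ?K" by auto
    have "induced D ?K \<in> \<Pi>\<^sub>1 \<or> induced D ?K \<in> \<Pi>\<^sub>2" using good v by (auto simp: components_def)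
    moreover have "W \<subseteq> verts (induced D ?K)" using WK WD by auto
    ultimately have "induced (induced D ?K) W \<in> \<Pi>\<^sub>1 \<union> \<Pi>\<^sub>2"
      using her unfolding hereditary_def by blast
    then show False using W iD[OF WD] induced_induced[OF WK] by (simp add: obstruction_def)
  next
    fix C assume hit: "\<forall>W. obstruction \<Pi>\<^sub>1 \<Pi>\<^sub>2 G W \<longrightarrow> W \<inter> S \<noteq> {}" and "C \<in> components D"
    then obtain v where v: "v \<in> verts D" "C = induced D ((edges D)\<^sup>* `` {v})"
      by (auto simp: components_def)
    let ?K = "(edges D)\<^sup>* `` {v}"
    have "?K \<inter> S = {}" "?K \<subseteq> verts G" using reach[OF v(1)] by (auto simp: vD)
    then show "C \<in> \<Pi>\<^sub>1 \<or> C \<in> \<Pi>\<^sub>2"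
      using hit[rule_format, of ?K] conn[OF v(1)] iD[OF reach[OF v(1)]] v(2)
      by (auto simp: obstruction_def)
  qed
  then show ?thesis using True unfolding deletion_set_def D_def by simp
qed (simp add: deletion_set_def)

locale scattered_pair =
  fixes \<Pi>\<^sub>1 \<Pi>\<^sub>2 \<F>\<^sub>1 \<F>\<^sub>2 :: "graph set" and \<alpha> d :: nat
  assumes closed: "graph_class \<Pi>\<^sub>1" "graph_class \<Pi>\<^sub>2"
    and her: "hereditary \<Pi>\<^sub>1" "hereditary \<Pi>\<^sub>2"
    and forb: "forbidden_family \<Pi>\<^sub>1 \<F>\<^sub>1" "forbidden_family \<Pi>\<^sub>2 \<F>\<^sub>2"
    and connected: "\<And>H. H \<in> \<F>\<^sub>1 \<union> \<F>\<^sub>2 \<Longrightarrow> connected_graph H"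
    and finite: "finite \<F>\<^sub>1" "finite \<F>\<^sub>2"
    and path: "\<exists>H\<in>\<F>\<^sub>1. isomorphic H (path_graph \<alpha>)"
    and d: "d = max_order \<F>\<^sub>1 + max_order \<F>\<^sub>2 + \<alpha> - 2"
begin

abbreviation "obstr \<equiv> obstruction \<Pi>\<^sub>1 \<Pi>\<^sub>2"

text \<open>Members of the families are nonempty because they are connected. It follows that
  \<open>max_order \<F>\<^sub>1 + \<alpha>\<close> is at least 2, so the truncated subtraction in
  \<open>d\<close> is exact.\<close>

lemma path_length: "0 < \<alpha>" "\<alpha> \<le> max_order \<F>\<^sub>1"
proof -
  obtain H where H: "H \<in> \<F>\<^sub>1" "isomorphic H (path_graph \<alpha>)" using path by blast
  have card: "card (verts H) = \<alpha>" using isomorphic_card[OF H(2)] by (simp add: path_graph_def)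
  have "verts H \<noteq> {}" "simple_graph H"
    using connected[of H] H(1) forb(1) by (auto simp: connected_graph_def forbidden_family_def)
  then show "0 < \<alpha>" using card by (auto simp: simple_graph_def card_gt_0_iff)
  show "\<alpha> \<le> max_order \<F>\<^sub>1" using card_le_max_order[OF finite(1) H(1)] card by simp
qed

lemma obstructionI:
  assumes G: "simple_graph G" and W: "W \<subseteq> verts G" "connected_graph (induced G W)"
    and A: "H1 \<in> \<F>\<^sub>1" "A \<subseteq> W" "isomorphic H1 (induced G A)"
    and B: "H2 \<in> \<F>\<^sub>2" "B \<subseteq> W" "isomorphic H2 (induced G B)"
  shows "obstr G W"
proof -
  have "contains_induced (induced G W) H1" "contains_induced (induced G W) H2"
    unfolding contains_induced_def
    using A B W induced_induced[of A W G] induced_induced[of B W G]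
    by (auto simp: Int_absorb1 intro: exI[of _ A] exI[of _ B])
  then show ?thesis
    using W A(1) B(1) connected_in_class_iff[OF forb(1) simple_graph_induced[OF G] W(2)]
      connected_in_class_iff[OF forb(2) simple_graph_induced[OF G] W(2)]
    by (auto simp: obstruction_def)
qed

lemma forbidden_copy:
  assumes "H \<in> \<F>\<^sub>1 \<union> \<F>\<^sub>2" "W \<subseteq> verts G" "isomorphic H (induced G W)"
  shows "finite W" "W \<noteq> {}" "connected_graph (induced G W)" "card W = card (verts H)"
proof -
  have H: "simple_graph H" "connected_graph H"
    using assms(1) forb connected[of H] by (auto simp: forbidden_family_def)
  show "connected_graph (induced G W)" using connected_isomorphic[OF H(2) assms(3) H(1)] .
  have W: "verts G \<inter> W = W" using assms(2) by blast
  show card: "card W = card (verts H)" using isomorphic_card[OF assms(3)] W by simp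
  have "0 < card (verts H)" using H by (auto simp: card_gt_0_iff simple_graph_def connected_graph_def)
  then show "finite W" "W \<noteq> {}" using card card_gt_0_iff[of W] by auto
qed

lemma small_obstruction:
  assumes G: "simple_graph G" and W: "obstr G W"
  obtains W' where "W' \<subseteq> W" "obstr G W'" "card W' \<le> d"
proof -
  define d\<^sub>1 d\<^sub>2 where "d\<^sub>1 = max_order \<F>\<^sub>1" and "d\<^sub>2 = max_order \<F>\<^sub>2"
  have WG: "W \<subseteq> verts G" and cW: "connected_graph (induced G W)"
    using W by (auto simp: obstruction_def)
  have vW: "verts (induced G W) = W" using WG by auto
  obtain H1 H2 where H: "H1 \<in> \<F>\<^sub>1" "H2 \<in> \<F>\<^sub>2" "contains_induced (induced G W) H1" "contains_induced (induced G W) H2"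
    using W connected_in_class_iff[OF forb(1) simple_graph_induced[OF G] cW]
      connected_in_class_iff[OF forb(2) simple_graph_induced[OF G] cW]
    by (auto simp: obstruction_def)
  obtain A where A: "A \<subseteq> W" "isomorphic H1 (induced G A)"
    using H(3) unfolding contains_induced_def vW by (auto simp: induced_induced)
  obtain B where B: "B \<subseteq> W" "isomorphic H2 (induced G B)"
    using H(4) unfolding contains_induced_def vW by (auto simp: induced_induced)
  note A' = forbidden_copy[OF UnI1[OF H(1)] order_trans[OF A(1) WG] A(2)]
  note B' = forbidden_copy[OF UnI2[OF H(2)] order_trans[OF B(1) WG] B(2)]
  have cA: "card A \<le> d\<^sub>1" and cB: "card B \<le> d\<^sub>2"
    using A'(4) B'(4) card_le_max_order[OF finite(1) H(1)] card_le_max_order[OF finite(2) H(2)]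
    by (auto simp: d\<^sub>1_def d\<^sub>2_def)
  \<comment> \<open>The path is taken inside \<open>G[W]\<close>, so it stays in \<open>W\<close>;
    between its vertices, \<open>R\<close> and the edges of \<open>G\<close> agree.\<close>
  define R where "R = edges (induced G W)"
  obtain u v where "u \<in> A" "v \<in> B" using A' B' by blast
  then have "(u, v) \<in> R\<^sup>*" using cW A(1) B(1) unfolding connected_graph_def vW R_def by blast
  from shortest_path[OF this \<open>u \<in> A\<close> \<open>v \<in> B\<close>] obtain p :: "nat \<Rightarrow> nat" and l where
    p: "p 0 \<in> A" "p l \<in> B" "\<And>i. i < l \<Longrightarrow> (p i, p (Suc i)) \<in> R" and
    short: "\<And>i j m. i \<le> j \<Longrightarrow> j \<le> l \<Longrightarrow> (p i, p j) \<in> R ^^ m \<Longrightarrow> j - i \<le> m" by metis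
  have pW: "p i \<in> W" if "i \<le> l" for i
    using that p(1) A(1) p(3)[of "i - 1"] by (cases i) (auto simp: R_def)
  have pe: "(p i, p (Suc i)) \<in> edges G" if "i < l" for i
    using p(3)[OF that] by (simp add: R_def)
  have walk: "connected_graph (induced G (p ` {a..b}))" if "a \<le> b" "b \<le> l" for a b
    using that pe pW[of a] WG by (intro connected_walk[OF G]) auto
  show ?thesis
  proof (cases "\<alpha> \<le> Suc l")
    case True
    \<comment> \<open>The last \<alpha> vertices of the path are those at positions \<open>s\<close>
      to \<open>l\<close>.\<close>
    define s where "s = Suc l - \<alpha>"
    have sl: "s + i \<le> l" if "i < \<alpha>" for i using that True by (simp add: s_def)
    define f where "f i = p (s + i)" for i
    have inj: "i = j" if "i < \<alpha>" "j < \<alpha>" "f i = f j" for i j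
    proof -
      have *: "(p (s + i), p (s + j)) \<in> R ^^ 0" "(p (s + j), p (s + i)) \<in> R ^^ 0"
        using that(3) by (simp_all add: f_def)
      show ?thesis
        using short[OF _ sl[OF that(2)] *(1)] short[OF _ sl[OF that(1)] *(2)] by linarith
    qed
    have near: "j = Suc i" if "i < j" "j < \<alpha>" "(f i, f j) \<in> edges G" for i j
    proof -
      have "(p (s + i), p (s + j)) \<in> R ^^ 1"
        using that pW[OF sl, of i] pW[OF sl, of j] by (auto simp: R_def f_def)
      from short[OF _ sl[OF that(2)] this] show ?thesis using that(1) by linarith
    qed
    have symG: "(x, y) \<in> edges G \<longleftrightarrow> (y, x) \<in> edges G" and irr: "(x, x) \<notin> edges G" for x y
      using G by (auto simp: simple_graph_def sym_def irrefl_def)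
    have step: "(f i, f (Suc i)) \<in> edges G" if "Suc i < \<alpha>" for i
      using pe[of "s + i"] sl[OF that] by (simp add: f_def)
    have edge: "(i, j) \<in> edges (path_graph \<alpha>) \<longleftrightarrow> (f i, f j) \<in> edges G" if "i < \<alpha>" "j < \<alpha>" for i j
    proof (cases i j rule: linorder_cases)
      case less
      then show ?thesis using that near[of i j] step[of i] by (auto simp: path_graph_def)
    next
      case equal
      then show ?thesis using irr by (simp add: path_graph_def)
    next
      case greater
      then show ?thesis using that near[of j i] step[of j] symG by (auto simp: path_graph_def)
    qed
    define P where "P = f ` {..<\<alpha>}"
    have P: "P = p ` {s..l}"
    proof -
      have "{s..l} = {0 + s..<\<alpha> + s}" using True by (auto simp: s_def)
      also have "\<dots> = (+) s ` {..<\<alpha>}"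
        by (simp only: image_add_atLeastLessThan lessThan_atLeast0)
      finally show ?thesis by (auto simp: P_def f_def)
    qed
    have PW: "P \<subseteq> W" unfolding P_def f_def using pW[OF sl] by auto
    have "isomorphic (induced (path_graph \<alpha>) {..<\<alpha>}) (induced G P)"
      unfolding P_def
    proof (rule isomorphic_induced)
      show "f ` {..<\<alpha>} \<subseteq> verts G" using PW WG by (auto simp: P_def)
      show "inj_on f {..<\<alpha>}" using inj by (auto simp: inj_on_def)
    qed (use edge in \<open>auto simp: path_graph_def\<close>)
    moreover have "induced (path_graph \<alpha>) {..<\<alpha>} = path_graph \<alpha>"
      by (auto simp: induced_def path_graph_def)
    ultimately obtain H where HP: "H \<in> \<F>\<^sub>1" "isomorphic H (induced G P)"
      using path isomorphic_trans by metis
    have "p l \<in> P \<inter> B" using p(2) path_length(1) by (auto simp: P s_def)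
    have "obstr G (P \<union> B)"
    proof (rule obstructionI[OF G _ _ HP(1) _ HP(2) H(2) _ B(2)])
      show "connected_graph (induced G (P \<union> B))"
      proof (rule connected_induced_Un)
        show "connected_graph (induced G P)"
          using walk[of s l] sl[OF path_length(1)] unfolding P by simp
        show "verts G \<inter> P \<inter> B \<noteq> {}" using \<open>p l \<in> P \<inter> B\<close> PW WG by blast
      qed (rule B'(3))
    qed (use PW B(1) WG in auto)
    \<comment> \<open>The shared vertex \<open>p l\<close> saves one, leaving at most
      \<open>\<alpha> + d\<^sub>2 - 1\<close> vertices. This is at most \<open>d\<close> because
      \<open>d\<^sub>1\<close> is at least 1.\<close>
    moreover have "card (P \<union> B) \<le> d"
    proof -
      have "card P \<le> \<alpha>" unfolding P_def using card_image_le[of "{..<\<alpha>}" f] by simp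
      moreover have "card P + card B = card (P \<union> B) + card (P \<inter> B)"
        using B'(1) by (intro card_Un_Int) (auto simp: P_def)
      moreover have "0 < card (P \<inter> B)" using \<open>p l \<in> P \<inter> B\<close> B'(1) by (auto simp: card_gt_0_iff)
      ultimately show ?thesis using cB d path_length unfolding d\<^sub>1_def[symmetric] d\<^sub>2_def[symmetric] by linarith
    qed
    moreover have "P \<union> B \<subseteq> W" using PW B(1) by blast
    ultimately show ?thesis by (intro that)
  next
    case False
    define P where "P = p ` {0..l}"
    have PW: "P \<subseteq> W" using pW by (auto simp: P_def)
    have pP: "p 0 \<in> P" "p l \<in> P" by (auto simp: P_def)
    have "obstr G (A \<union> P \<union> B)"
    proof (rule obstructionI[OF G _ _ H(1) _ A(2) H(2) _ B(2)])
      show "connected_graph (induced G (A \<union> P \<union> B))"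
        using walk[of 0 l] A'(3) B'(3) pP p(1,2) PW WG
        by (intro connected_induced_Un) (auto simp: P_def[symmetric])
    qed (use PW A(1) B(1) WG in auto)
    moreover have "card (A \<union> P \<union> B) \<le> d"
    proof -
      \<comment> \<open>The ends of the path lie in \<open>A\<close> and \<open>B\<close>, so only
        \<open>l - 1\<close> vertices are new, or none if \<open>l = 0\<close>. In this case
        \<open>l + 2\<close> is at most \<alpha>, which gives at most
        \<open>d\<^sub>1 + d\<^sub>2 + \<alpha> - 2\<close> in total.\<close>
      have "P \<subseteq> A \<union> B \<union> p ` {1..<l}"
      proof
        fix x assume "x \<in> P"
        then obtain i where "i \<le> l" "x = p i" by (auto simp: P_def)
        then show "x \<in> A \<union> B \<union> p ` {1..<l}"
          using p(1,2) by (cases "i = 0 \<or> i = l") auto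
      qed
      then have "card (A \<union> P \<union> B) \<le> card (A \<union> B \<union> p ` {1..<l})"
        using A'(1) B'(1) by (intro card_mono) auto
      also have "\<dots> \<le> card A + card B + card (p ` {1..<l})"
        by (meson add_le_mono1 card_Un_le le_trans)
      also have "card (p ` {1..<l}) \<le> l - 1"
        using card_image_le[of "{1..<l}" p] by simp
      finally show ?thesis
        using False cA cB d path_length unfolding d\<^sub>1_def[symmetric] d\<^sub>2_def[symmetric] by linarith
    qed
    moreover have "A \<union> P \<union> B \<subseteq> W" using PW A(1) B(1) by blast
    ultimately show ?thesis by (intro that)
  qed
qed

text \<open>Repeating the least vertex pads a small obstruction to length exactly \<open>d\<close>,
  so tuples of a single length suffice.\<close>

lemma obstruction_tuple:
  assumes "simple_graph G" "obstr G W"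
  obtains xs where "length xs = d" "set xs \<subseteq> W" "obstr G (set xs)"
proof -
  obtain W' where W': "W' \<subseteq> W" "obstr G W'" "card W' \<le> d"
    using small_obstruction[OF assms] .
  then have "finite W'" "W' \<noteq> {}"
    using assms(1) finite_subset by (auto simp: obstruction_def simple_graph_def connected_graph_def)
  define xs where "xs = sorted_list_of_set W' @ replicate (d - card W') (Min W')"
  have "length xs = d" "set xs = W'"
    using \<open>finite W'\<close> \<open>W' \<noteq> {}\<close> W'(3) by (auto simp: xs_def intro: Min_in)
  then show ?thesis using that W' by blast
qed

text \<open>This is the hitting set formulation on which both algorithms work.\<close>

lemma deletion_set_tuples:
  assumes "simple_graph G"
  shows "deletion_set \<Pi>\<^sub>1 \<Pi>\<^sub>2 G S \<longleftrightarrow> S \<subseteq> verts G \<and>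
    (\<forall>xs. length xs = d \<and> obstr G (set xs) \<longrightarrow> set xs \<inter> S \<noteq> {})"
proof -
  have "W \<inter> S \<noteq> {}" if "\<forall>xs. length xs = d \<and> obstr G (set xs) \<longrightarrow> set xs \<inter> S \<noteq> {}" "obstr G W" for W
    using obstruction_tuple[OF assms that(2)] that(1) by (metis disjoint_iff subset_iff)
  then show ?thesis unfolding deletion_set_iff[OF assms her] by blast
qed

section \<open>Equality and adjacency patterns of tuples\<close>

text \<open>Records both the equality pattern (\<^const>\<open>True\<close>) and the adjacency pattern (\<^const>\<open>False\<close>)
  of a tuple.\<close>

definition pattern_at :: "graph \<Rightarrow> nat list \<Rightarrow> bool \<times> nat \<times> nat \<Rightarrow> bool" where
  "pattern_at G xs = (\<lambda>(b, i, j). if b then xs ! i = xs ! j else (xs ! i, xs ! j) \<in> edges G)"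

definition pattern :: "graph \<Rightarrow> nat list \<Rightarrow> (bool \<times> nat \<times> nat) set" where
  "pattern G xs = {a \<in> UNIV \<times> {..<d} \<times> {..<d}. pattern_at G xs a}"

text \<open>The existential quantifier ranges over all graphs, so this is a property of the pattern
  alone, independent of the input; it can be wired into a program as the \<open>\<Phi>\<close> of
  \<open>ptime_finite_pattern\<close>.\<close>

definition bad_pattern :: "(bool \<times> nat \<times> nat) set \<Rightarrow> bool" where
  "bad_pattern p \<longleftrightarrow> (\<exists>G xs. simple_graph G \<and> length xs = d \<and> pattern G xs = p \<and> obstr G (set xs))"

text \<open>Sending \<open>xs ! i\<close> to \<open>ys ! i\<close> is well defined and injective
  because the equality patterns coincide, and it preserves adjacency because the adjacency patterns
  do. Hence every realization of a pattern is an obstruction as soon as one is.\<close>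

lemma bad_pattern_iff:
  assumes "simple_graph H" "length ys = d" "set ys \<subseteq> verts H"
  shows "bad_pattern (pattern H ys) \<longleftrightarrow> obstr H (set ys)"
proof
  assume "bad_pattern (pattern H ys)"
  then obtain G xs where G: "simple_graph G" "length xs = d" "pattern G xs = pattern H ys"
    and W: "obstr G (set xs)"
    unfolding bad_pattern_def by blast
  have pat: "pattern_at G xs (b, i, j) = pattern_at H ys (b, i, j)" if "i < d" "j < d" for b i j
    using G(3) that unfolding pattern_def by (auto simp: set_eq_iff)
  have eq: "xs ! i = xs ! j \<longleftrightarrow> ys ! i = ys ! j"
    and edge: "(xs ! i, xs ! j) \<in> edges G \<longleftrightarrow> (ys ! i, ys ! j) \<in> edges H" if "i < d" "j < d" for i j
    using pat[OF that, of True] pat[OF that, of False] by (auto simp: pattern_at_def)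
  define f where "f v = ys ! (SOME i. i < d \<and> xs ! i = v)" for v
  have f: "f (xs ! i) = ys ! i" if "i < d" for i
  proof -
    have "(SOME j. j < d \<and> xs ! j = xs ! i) < d \<and> xs ! (SOME j. j < d \<and> xs ! j = xs ! i) = xs ! i"
      by (rule someI[of _ i]) (simp add: that)
    then show ?thesis unfolding f_def using eq that by blast
  qed
  have xs: "\<exists>i<d. v = xs ! i" if "v \<in> set xs" for v using that G(2) by (metis in_set_conv_nth)
  have "map f xs = ys" using f G(2) assms(2) by (intro nth_equalityI) auto
  then have img: "f ` set xs = set ys" by auto
  have "obstr H (f ` set xs)"
  proof (rule obstruction_transfer[OF closed G(1) assms(1) _ _ _ W])
    show "inj_on f (set xs)" by (rule inj_onI) (use xs f eq in metis)
    show "(u, v) \<in> edges G \<longleftrightarrow> (f u, f v) \<in> edges H" if "u \<in> set xs" "v \<in> set xs" for u v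
      using xs[OF that(1)] xs[OF that(2)] f edge by auto
  qed (use img assms(3) in auto)
  then show "obstr H (set ys)" unfolding img .
qed (use assms in \<open>auto simp: bad_pattern_def\<close>)

end

section \<open>Greedy packings and kernels of tuple families\<close>

lemma greedy_Nil [simp]: "greedy P [] = []"
  by (simp add: greedy_def)

lemma greedy_snoc:
  "greedy P (xs @ [x]) = (if P x (greedy P xs) then x # greedy P xs else greedy P xs)"
  by (simp add: greedy_def)

text \<open>In the second case \<open>ys\<close> is the list of elements already accepted at the
  moment when \<open>x\<close> passes its test.\<close>

lemma greedy_induct [consumes 0, case_names Nil Cons]:
  assumes "Q []" "\<And>x ys. x \<in> set xs \<Longrightarrow> set ys \<subseteq> set xs \<Longrightarrow> P x ys \<Longrightarrow> Q ys \<Longrightarrow> Q (x # ys)"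
  shows "Q (greedy P xs)"
proof -
  have "Q (greedy P zs) \<and> set (greedy P zs) \<subseteq> set zs" if "set zs \<subseteq> set xs" for zs
    using that
  proof (induction zs rule: rev_induct)
    case (snoc z zs)
    have "set (greedy P zs) \<subseteq> set xs" using snoc by auto
    then show ?case using snoc assms(2)[of z "greedy P zs"] by (auto simp: greedy_snoc)
  qed (use assms(1) in simp)
  then show ?thesis by blast
qed

lemma set_greedy: "set (greedy P xs) \<subseteq> set xs"
  by (induction rule: greedy_induct) auto

text \<open>The selection only ever grows at the front, so what had been accepted when
  \<open>x\<close> failed survives as the suffix \<open>ys\<close>.\<close>

lemma greedy_rejected:
  assumes "x \<in> set xs" "x \<notin> set (greedy P xs)"
  obtains us ys where "greedy P xs = us @ ys" "\<not> P x ys"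
proof -
  have "x \<in> set (greedy P xs) \<or> (\<exists>us ys. greedy P xs = us @ ys \<and> \<not> P x ys)"
    using assms(1)
  proof (induction xs rule: rev_induct)
    case (snoc z zs)
    show ?case
    proof (cases "x = z")
      case True
      then show ?thesis by (auto simp: greedy_snoc)
    next
      case False
      with snoc have IH: "x \<in> set (greedy P zs) \<or> (\<exists>us ys. greedy P zs = us @ ys \<and> \<not> P x ys)"
        by simp
      show ?thesis
      proof (cases "P z (greedy P zs)")
        case True
        then show ?thesis using IH by (auto simp: greedy_snoc)
      qed (use IH in \<open>simp add: greedy_snoc\<close>)
    qed
  qed simp
  then show ?thesis using assms(2) that by blast
qed

text \<open>This links the programs to the mathematics: programs select among encoded tuples, the
  correctness proofs among the tuples themselves.\<close>

lemma greedy_map: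
  assumes "\<And>x ys. x \<in> set xs \<Longrightarrow> set ys \<subseteq> set xs \<Longrightarrow> P (e x) (map e ys) = P' x ys"
  shows "greedy P (map e xs) = map e (greedy P' xs)"
proof -
  have "greedy P (map e zs) = map e (greedy P' zs)" if "set zs \<subseteq> set xs" for zs
    using that
  proof (induction zs rule: rev_induct)
    case (snoc z zs)
    have "set (greedy P' zs) \<subseteq> set xs" using snoc.prems set_greedy[of P' zs] by auto
    then show ?case using snoc assms[of z "greedy P' zs"] by (simp add: greedy_snoc)
  qed simp
  then show ?thesis by blast
qed

text \<open>A union bound that counts list positions instead of elements.\<close>

lemma length_filter_le_sum:
  assumes "finite A" "\<And>y. y \<in> set ys \<Longrightarrow> Q y \<Longrightarrow> \<exists>a\<in>A. Q' a y"
  shows "length (filter Q ys) \<le> (\<Sum>a\<in>A. length (filter (Q' a) ys))"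
  using assms(2)
proof (induction ys)
  case (Cons y ys)
  have "(if Q y then 1 else 0) \<le> (\<Sum>a\<in>A. if Q' a y then 1 else (0::nat))"
  proof (cases "Q y")
    case True
    then obtain a where a: "a \<in> A" "Q' a y" using Cons.prems[of y] by auto
    then show ?thesis
      using member_le_sum[OF a(1) _ assms(1), of "\<lambda>a. if Q' a y then 1 else (0::nat)"] True by simp
  qed simp
  moreover have "(\<Sum>a\<in>A. length (filter (Q' a) (y # ys))) =
      (\<Sum>a\<in>A. if Q' a y then 1 else 0) + (\<Sum>a\<in>A. length (filter (Q' a) ys))"
    unfolding sum.distrib[symmetric] by (intro sum.cong) auto
  moreover have "length (filter Q ys) \<le> (\<Sum>a\<in>A. length (filter (Q' a) ys))"
    using Cons by auto
  ultimately show ?case by (auto split: if_splits)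
qed simp

section \<open>Disjoint packings and bounded tuple families\<close>

abbreviation tuples :: "nat \<Rightarrow> nat \<Rightarrow> nat list list" where
  "tuples d n \<equiv> List.n_lists d [0..<n]"

lemma card_Union_tuples:
  "\<forall>x\<in>set xs. length x = d \<Longrightarrow> card (\<Union> (set ` set xs)) \<le> d * length xs"
proof (induction xs)
  case (Cons x xs)
  have "card (\<Union> (set ` set (x # xs))) \<le> card (set x) + card (\<Union> (set ` set xs))"
    by (simp add: card_Un_le)
  also have "card (set x) \<le> d" using Cons.prems card_length[of x] by simp
  finally show ?case using Cons by simp
qed simp

definition packing_step :: "(nat list \<Rightarrow> bool) \<Rightarrow> nat list \<Rightarrow> nat list list \<Rightarrow> bool" where
  "packing_step Q x ys \<longleftrightarrow> Q x \<and> \<not> (\<exists>y\<in>set ys. \<exists>v\<in>set x. v \<in> set y)"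

text \<open>Accepted tuples are pairwise disjoint and each contains an element of \<open>S\<close>.
  The induction counts only the elements of \<open>S\<close> already covered, so that each new tuple
  adds at least one.\<close>

lemma packing_length_le:
  assumes "finite S" "\<And>x. x \<in> set xs \<Longrightarrow> Q x \<Longrightarrow> set x \<inter> S \<noteq> {}"
  shows "length (greedy (packing_step Q) xs) \<le> card S"
proof -
  have "length (greedy (packing_step Q) xs) \<le> card (S \<inter> \<Union> (set ` set (greedy (packing_step Q) xs)))"
  proof (induction rule: greedy_induct)
    case (Cons x ys)
    let ?U = "\<Union> (set ` set ys)"
    have "set x \<inter> ?U = {}" using Cons(3) by (auto simp: packing_step_def)
    then have "card (S \<inter> \<Union> (set ` set (x # ys))) = card (S \<inter> set x) + card (S \<inter> ?U)"
      using assms(1) by (subst card_Un_disjoint[symmetric]) (auto simp: Int_Un_distrib)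
    moreover have "0 < card (S \<inter> set x)"
      using assms(1,2) Cons(1,3) by (auto simp: packing_step_def card_gt_0_iff)
    ultimately show ?case using Cons(4) by simp
  qed simp
  also have "\<dots> \<le> card S" using assms(1) by (intro card_mono) auto
  finally show ?thesis .
qed

text \<open>The packing is maximal: a rejected tuple satisfying \<open>Q\<close> shares a vertex
  with an accepted one, and an accepted tuple meets itself.\<close>

lemma packing_hits:
  assumes "x \<in> set xs" "Q x" "set x \<noteq> {}"
  shows "set x \<inter> \<Union> (set ` set (greedy (packing_step Q) xs)) \<noteq> {}"
proof (cases "x \<in> set (greedy (packing_step Q) xs)")
  case False
  then obtain us ys where "greedy (packing_step Q) xs = us @ ys" "\<not> packing_step Q x ys"
    using greedy_rejected[OF assms(1)] by blast
  then show ?thesis using assms(2) by (auto simp: packing_step_def)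
next
  case True
  then have "set x \<subseteq> \<Union> (set ` set (greedy (packing_step Q) xs))" by blast
  then show ?thesis using assms(3) by (simp only: Int_absorb2 not_False_eq_True)
qed

definition agree :: "nat set \<Rightarrow> nat list \<Rightarrow> nat list \<Rightarrow> bool" where
  "agree I x y \<longleftrightarrow> (\<forall>i\<in>I. y ! i = x ! i)"

text \<open>The extreme choices of \<open>I\<close> are instructive: the empty set limits the total
  number of kept tuples, and the full set, with bound 1, excludes repetitions.\<close>

definition kernel_step :: "nat \<Rightarrow> nat \<Rightarrow> (nat list \<Rightarrow> bool) \<Rightarrow> nat list \<Rightarrow> nat list list \<Rightarrow> bool" where
  "kernel_step d k Q x ys \<longleftrightarrow> Q x \<and>
     (\<forall>I\<in>Pow {..<d}. length (filter (agree I x) ys) < (d * k + 1) ^ (d - card I))"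

text \<open>An accepted \<open>x\<close> raises the count only if it agrees with \<open>z\<close> on
  \<open>I\<close>. Then agreeing with \<open>z\<close> and agreeing with \<open>x\<close> are the
  same, and the test passed by \<open>x\<close> left room for one more. Since \<open>z\<close> is
  arbitrary, it may later be a modified tuple.\<close>

lemma kernel_agree_le:
  assumes "I \<subseteq> {..<d}"
  shows "length (filter (agree I z) (greedy (kernel_step d k Q) xs)) \<le> (d * k + 1) ^ (d - card I)"
proof (induction rule: greedy_induct)
  case (Cons x ys)
  show ?case
  proof (cases "agree I z x")
    case True
    then have "agree I z = agree I x" by (auto simp: agree_def)
    then show ?thesis using Cons(3) assms True by (auto simp: kernel_step_def Suc_le_eq)
  qed (use Cons(4) in simp)
qed simp

text \<open>If \<open>S\<close> missed a rejected tuple \<open>x\<close>, all kept tuples that agree with \<open>x\<close> on a saturated set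
  \<open>I\<close> of positions would be hit in one of at most \<open>d\<close> further positions by one of at most \<open>k\<close>
  vertices, which leaves too few of them.\<close>

lemma kernel_hits:
  assumes S: "finite S" "card S \<le> k"
    and hit: "\<And>y. y \<in> set (greedy (kernel_step d k Q) xs) \<Longrightarrow> set y \<inter> S \<noteq> {}"
    and len: "\<And>y. y \<in> set xs \<Longrightarrow> length y = d"
    and x: "x \<in> set xs" "Q x"
  shows "set x \<inter> S \<noteq> {}"
proof
  define R where "R = greedy (kernel_step d k Q) xs"
  assume miss: "set x \<inter> S = {}"
  then have "x \<notin> set R" using hit unfolding R_def by blast
  then obtain us ys where R: "R = us @ ys" "\<not> kernel_step d k Q x ys"
    using greedy_rejected[OF x(1)] unfolding R_def by blast
  then obtain I where I: "I \<subseteq> {..<d}" "(d * k + 1) ^ (d - card I) \<le> length (filter (agree I x) ys)"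
    using x(2) by (auto simp: kernel_step_def not_less)
  \<comment> \<open>A pair \<open>(j, s)\<close> stands for a hit at position \<open>j\<close> by
    the vertex \<open>s\<close>. Since \<open>x\<close> avoids \<open>S\<close>, a tuple agreeing
    with \<open>x\<close> on \<open>I\<close> can be hit only outside \<open>I\<close>.\<close>
  define A where "A = ({..<d} - I) \<times> S"
  have A: "finite A" using S(1) by (simp add: A_def)
  have "length (filter (agree I x) R) \<le>
      (\<Sum>a\<in>A. length (filter (agree (insert (fst a) I) (x[fst a := snd a])) R))"
  proof (rule length_filter_le_sum[OF A, where Q' = "\<lambda>a. agree (insert (fst a) I) (x[fst a := snd a])"])
    fix y assume y: "y \<in> set R" "agree I x y"
    have "y \<in> set xs" using subsetD[OF set_greedy] y(1) unfolding R_def .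
    then have leny: "length y = d" by (rule len)
    have "set y \<inter> S \<noteq> {}" by (rule hit) (use y(1) R_def in simp)
    then obtain s where s: "s \<in> set y" "s \<in> S" by blast
    then obtain j where j: "j < d" "y ! j = s" using leny by (auto simp: in_set_conv_nth)
    have "x ! j \<in> set x" using j(1) len[OF x(1)] by simp
    then have "x ! j \<noteq> s" using s(2) miss by blast
    then have "j \<notin> I" using y(2) j(2) by (auto simp: agree_def)
    then have "(j, s) \<in> A" using j s by (simp add: A_def)
    moreover have "agree (insert j I) (x[j := s]) y"
      using y(2) j \<open>j \<notin> I\<close> len[OF x(1)] by (auto simp: agree_def nth_list_update)
    ultimately show "\<exists>a\<in>A. agree (insert (fst a) I) (x[fst a := snd a]) y"
      by (intro bexI[of _ "(j, s)"]) auto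
  qed
  also have "\<dots> \<le> (\<Sum>a\<in>A. (d * k + 1) ^ (d - Suc (card I)))"
  proof (rule sum_mono)
    fix a assume a: "a \<in> A"
    have "card (insert (fst a) I) = Suc (card I)"
      using a I(1) finite_subset by (subst card_insert_disjoint) (auto simp: A_def)
    then show "length (filter (agree (insert (fst a) I) (x[fst a := snd a])) R)
        \<le> (d * k + 1) ^ (d - Suc (card I))"
      using kernel_agree_le[of "insert (fst a) I" d] a I(1) unfolding R_def by (auto simp: A_def)
  qed
  also have "\<dots> = card A * (d * k + 1) ^ (d - Suc (card I))" by simp
  \<comment> \<open>There are at most \<open>d * k\<close> pairs, one less than the factor lost by
    enlarging \<open>I\<close>. If \<open>A\<close> is empty, the left side is 0 and the right side
    is positive.\<close>
  also have "\<dots> < (d * k + 1) ^ (d - card I)"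
  proof (cases "A = {}")
    case False
    then have "I \<subset> {..<d}" using I(1) by (auto simp: A_def)
    then have "card I < d" using psubset_card_mono[of "{..<d}" I] by simp
    then have eq: "(d * k + 1) ^ (d - card I) = (d * k + 1) * (d * k + 1) ^ (d - Suc (card I))"
      by (simp flip: power_Suc add: Suc_diff_Suc)
    have "card ({..<d} - I) \<le> card {..<d}" by (intro card_mono) auto
    then have "card A \<le> d * k" using S(2) by (simp add: A_def card_cartesian_product mult_le_mono)
    then have "card A < d * k + 1" by simp
    then show ?thesis unfolding eq by (intro mult_strict_right_mono) auto
  qed simp
  also have "\<dots> \<le> length (filter (agree I x) R)" using I(2) R(1) by simp
  finally show False by simp
qed

section \<open>Induced subgraphs with renamed vertices\<close>

text \<open>Positions in \<open>vs\<close> become the new vertices, because the vertex set of an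
  instance graph has to be an initial segment of the naturals.\<close>

definition kernel_graph :: "graph \<Rightarrow> nat list \<Rightarrow> graph" where
  "kernel_graph G vs = Graph {..<length vs}
     {(i, j). i < length vs \<and> j < length vs \<and> (vs ! i, vs ! j) \<in> edges G}"

lemma kernel_graph_simps [simp]:
  "verts (kernel_graph G vs) = {..<length vs}"
  "(i, j) \<in> edges (kernel_graph G vs) \<longleftrightarrow> i < length vs \<and> j < length vs \<and> (vs ! i, vs ! j) \<in> edges G"
  by (simp_all add: kernel_graph_def)

lemma simple_kernel_graph: "simple_graph G \<Longrightarrow> simple_graph (kernel_graph G vs)"
  by (auto simp: simple_graph_def kernel_graph_def sym_def irrefl_def)

lemma kernel_graph_instance: "simple_graph G \<Longrightarrow> kernel_graph G vs \<in> instance_graphs"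
  by (simp add: instance_graphs_def simple_kernel_graph)

lemma card_edges_kernel_graph: "card (edges (kernel_graph G vs)) \<le> length vs * length vs"
proof -
  have "edges (kernel_graph G vs) \<subseteq> {..<length vs} \<times> {..<length vs}" by auto
  from card_mono[OF _ this] show ?thesis by (simp add: card_cartesian_product)
qed

text \<open>The new matrix is obtained by querying the old one at pairs of entries of
  \<open>vs\<close>, so the program never has to compute the new names.\<close>

lemma enc_kernel_graph:
  "enc_graph (kernel_graph G vs) =
     enc_list (enc_list enc_bool) (map (\<lambda>u. map (\<lambda>v. (u, v) \<in> edges G) vs) vs)"
proof -
  have "map (\<lambda>u. map (\<lambda>v. (u, v) \<in> edges (kernel_graph G vs)) [0..<length vs]) [0..<length vs] =
      map (\<lambda>u. map (\<lambda>v. (u, v) \<in> edges G) vs) vs"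
    by (intro nth_equalityI) auto
  then show ?thesis unfolding enc_graph_def Let_def by simp
qed

section \<open>The algorithms\<close>

lemma enc_nat_eq_iff [simp]: "enc_nat m = enc_nat n \<longleftrightarrow> m = n"
proof (induction m arbitrary: n)
  case 0
  show ?case by (cases n) auto
next
  case (Suc m)
  then show ?case by (cases n) auto
qed

lemma len_enc_nat [simp]: "len (enc_nat n) = n"
  by (induction n) auto

definition nth_tree :: "tree \<Rightarrow> nat \<Rightarrow> tree" where
  "nth_tree t n = left ((right ^^ n) t)"

lemma nth_tree_enc: "n < length xs \<Longrightarrow> nth_tree (enc_list e xs) n = e (xs ! n)"
  unfolding enc_map[of e, symmetric] nth_tree_def right_enc drop_map
  by (subst Cons_nth_drop_Suc[symmetric]) simp_all

text \<open>A unary number is a list whose length is its value, so it directly controls how many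
  cells are skipped in the matrix.\<close>

definition adj_tree :: "tree \<Rightarrow> tree \<Rightarrow> tree \<Rightarrow> tree" where
  "adj_tree M u v = nth_tree (nth_tree M (len u)) (len v)"

lemma adj_tree_enc:
  assumes "u < card (verts G)" "v < card (verts G)"
  shows "adj_tree (enc_graph G) (enc_nat u) (enc_nat v) = enc_bool ((u, v) \<in> edges G)"
  using assms unfolding adj_tree_def enc_graph_def Let_def by (simp add: nth_tree_enc)

lemma ptime_adj_tree:
  assumes "ptime M" "ptime u" "ptime v"
  shows "ptime (\<lambda>x. adj_tree (M x) (u x) (v x))"
  unfolding adj_tree_def nth_tree_def
  by (intro ptime_left ptime_funpow_right ptime_elems assms)

lemma len_enc_graph [simp]: "len (enc_graph G) = card (verts G)"
  by (simp add: enc_graph_def Let_def)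

text \<open>Filtering the list of all vertices, instead of collecting tuple entries, yields an
  increasing list without repetitions, as \<open>enc_set\<close> and the renaming in the kernel
  require.\<close>

definition covered_vertices :: "tree \<Rightarrow> tree list \<Rightarrow> tree list" where
  "covered_vertices M R = filter (\<lambda>v. \<exists>t\<in>set R. \<exists>u\<in>set (elems t). u = v) (map enc_nat [0..<len M])"

lemma covered_vertices_enc:
  "covered_vertices M (map (enc_list enc_nat) R) =
     map enc_nat (filter (\<lambda>v. v \<in> \<Union> (set ` set R)) [0..<len M])"
proof -
  have "enc_nat v \<in> enc_nat ` A \<longleftrightarrow> v \<in> A" for v A by auto
  then show ?thesis unfolding covered_vertices_def filter_map by (simp add: comp_def)
qed

lemma ptime_covered_vertices:
  assumes "ptime M" "ptime (\<lambda>x. enc (R x))"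
  shows "ptime (\<lambda>x. enc (covered_vertices (M x) (R x)))"
  unfolding covered_vertices_def
  apply (rule ptime_filter)
   apply (rule ptime_bex)
    apply (rule ptime_bex)
     apply (intro ptime_equal ptime_left ptime_right ptime_id ptime_elems)+
   apply (rule ptime_subst[OF assms(2)])
   apply (intro ptime_left ptime_right ptime_id)
  apply (simp add: enc_map ptime_upt[OF ptime_elems[OF assms(1)]])
  done

definition tuple_trees :: "nat \<Rightarrow> tree \<Rightarrow> tree list" where
  "tuple_trees d M = map enc (List.n_lists d (map enc_nat [0..<len M]))"

lemma n_lists_map: "List.n_lists n (map f xs) = map (map f) (List.n_lists n xs)"
  by (induction n) (auto simp: map_concat comp_def)

lemma tuple_trees_eq: "tuple_trees d M = map (enc_list enc_nat) (tuples d (len M))"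
  by (simp add: tuple_trees_def n_lists_map comp_def enc_map)

lemma ptime_tuple_trees: "ptime M \<Longrightarrow> ptime (\<lambda>x. enc (tuple_trees d (M x)))"
  unfolding tuple_trees_def enc_map
  by (intro ptime_n_lists) (simp add: enc_map ptime_upt[OF ptime_elems])

context scattered_pair
begin

definition obstr_tree :: "tree \<Rightarrow> tree \<Rightarrow> bool" where
  "obstr_tree M t \<longleftrightarrow> bad_pattern {a \<in> UNIV \<times> {..<d} \<times> {..<d}.
     (case a of (b, i, j) \<Rightarrow> if b then nth_tree t i = nth_tree t j
       else adj_tree M (nth_tree t i) (nth_tree t j) \<noteq> Leaf)}"

lemma obstr_tree_enc:
  assumes "G \<in> instance_graphs" "x \<in> set (tuples d (card (verts G)))"
  shows "obstr_tree (enc_graph G) (enc_list enc_nat x) \<longleftrightarrow> obstr G (set x)"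
proof -
  have G: "simple_graph G" "verts G = {..<card (verts G)}"
    using assms(1) by (auto simp: instance_graphs_def)
  have x: "length x = d" "set x \<subseteq> {..<card (verts G)}"
    using assms(2) by (auto simp: set_n_lists)
  have lt: "x ! i < card (verts G)" if "i < d" for i using x that nth_mem[of i x] by (metis lessThan_iff subsetD)
  have eb: "enc_bool b \<noteq> Leaf \<longleftrightarrow> b" for b by (cases b) auto
  have "{a \<in> UNIV \<times> {..<d} \<times> {..<d}.
     (case a of (b, i, j) \<Rightarrow> if b then nth_tree (enc_list enc_nat x) i = nth_tree (enc_list enc_nat x) j
       else adj_tree (enc_graph G) (nth_tree (enc_list enc_nat x) i) (nth_tree (enc_list enc_nat x) j) \<noteq> Leaf)}
     = pattern G x"
    unfolding pattern_def pattern_at_def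
    using x(1) lt by (auto simp: nth_tree_enc adj_tree_enc eb simp del: len_enc_nat split: if_splits)
  then show ?thesis
    unfolding obstr_tree_def using bad_pattern_iff[OF G(1) x(1)] x(2) G(2) by simp
qed

text \<open>Only the equality and adjacency tests for pairs of positions run on the input;
  \<open>bad_pattern\<close> is a constant table.\<close>

lemma ptime_obstr_tree:
  assumes "ptime M" "ptime t"
  shows "ptime (\<lambda>x. enc_bool (obstr_tree (M x) (t x)))"
  unfolding obstr_tree_def
proof (rule ptime_finite_pattern)
  fix a :: "bool \<times> nat \<times> nat"
  obtain b i j where a: "a = (b, i, j)" by (cases a)
  have t: "ptime (\<lambda>x. nth_tree (t x) i)" for i
    unfolding nth_tree_def by (rule ptime_nth[OF assms(2)])
  show "ptime (\<lambda>x. enc_bool (case a of (b, i, j) \<Rightarrow> if b then nth_tree (t x) i = nth_tree (t x) j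
       else adj_tree (M x) (nth_tree (t x) i) (nth_tree (t x) j) \<noteq> Leaf))"
    unfolding a by (cases b) (auto intro!: ptime_equal ptime_not ptime_adj_tree t assms(1) ptime_Leaf)
qed simp

section \<open>The approximation algorithm\<close>

definition approx_tuples :: "graph \<Rightarrow> nat list list" where
  "approx_tuples G = greedy (packing_step (\<lambda>x. obstr G (set x))) (tuples d (card (verts G)))"

definition approx_set :: "graph \<Rightarrow> nat set" where
  "approx_set G = \<Union> (set ` set (approx_tuples G))"

definition packing_tree_step :: "tree \<Rightarrow> tree \<Rightarrow> tree list \<Rightarrow> bool" where
  "packing_tree_step M t ts \<longleftrightarrow> obstr_tree M t \<and>
     \<not> (\<exists>s\<in>set ts. \<exists>v\<in>set (elems t). \<exists>u\<in>set (elems s). u = v)"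

lemma ptime_packing_tree_step:
  "ptime (\<lambda>z. enc_bool (packing_tree_step (left z) (left (right z)) (elems (right (right z)))))"
  unfolding packing_tree_step_def
  apply (rule ptime_conj)
   apply (intro ptime_obstr_tree ptime_left ptime_right ptime_id)
  apply (rule ptime_not)
  apply (rule ptime_bex)
   apply (rule ptime_bex)
    apply (rule ptime_bex)
     apply (intro ptime_equal ptime_left ptime_right ptime_id ptime_elems)+
  done

lemma approx_tuples_tree:
  assumes "G \<in> instance_graphs"
  shows "greedy (packing_tree_step (enc_graph G)) (tuple_trees d (enc_graph G)) =
    map (enc_list enc_nat) (approx_tuples G)"
  unfolding approx_tuples_def tuple_trees_eq len_enc_graph
proof (rule greedy_map)
  fix x ys assume x: "x \<in> set (tuples d (card (verts G)))"
  show "packing_tree_step (enc_graph G) (enc_list enc_nat x) (map (enc_list enc_nat) ys) =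
      packing_step (\<lambda>x. obstr G (set x)) x ys"
    unfolding packing_tree_step_def packing_step_def obstr_tree_enc[OF assms x] by auto
qed

lemma approx_set_subset: "approx_set G \<subseteq> {..<card (verts G)}"
  unfolding approx_set_def approx_tuples_def
  using set_greedy[of _ "tuples d (card (verts G))"] by (fastforce simp: set_n_lists)

lemma polytime_approx_set: "polytime_computable instance_graphs enc_graph enc_set approx_set"
proof (rule ptime_imp_polytime_computable)
  show "ptime (\<lambda>M. enc (covered_vertices M (greedy (packing_tree_step M) (tuple_trees d M))))"
    by (intro ptime_covered_vertices ptime_greedy ptime_packing_tree_step ptime_tuple_trees ptime_id)
  fix G assume G: "G \<in> instance_graphs"
  have "sorted_list_of_set (approx_set G) = filter (\<lambda>v. v \<in> approx_set G) [0..<card (verts G)]"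
    by (rule sorted_distinct_set_unique)
      (use approx_set_subset finite_subset[OF approx_set_subset] in \<open>auto simp: sorted_wrt_filter\<close>)
  then show "enc (covered_vertices (enc_graph G)
      (greedy (packing_tree_step (enc_graph G)) (tuple_trees d (enc_graph G)))) = enc_set (approx_set G)"
    by (simp add: approx_tuples_tree[OF G] covered_vertices_enc enc_set_def approx_set_def enc_map)
qed

lemma obstr_tuples:
  assumes "G \<in> instance_graphs" "length x = d" "obstr G (set x)"
  shows "x \<in> set (tuples d (card (verts G)))"
  using assms by (auto simp: set_n_lists obstruction_def instance_graphs_def)

text \<open>A feasible set meets all the disjoint packed tuples, so it has at least as many elements
  as there are tuples, and their union has at most \<open>d\<close> times as many.\<close>

lemma approximation: "approximation_algorithm (deletion_set \<Pi>\<^sub>1 \<Pi>\<^sub>2) d approx_set"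
  unfolding approximation_algorithm_def
proof (intro conjI ballI polytime_approx_set)
  fix G assume G: "G \<in> instance_graphs"
  then have sG: "simple_graph G" and vG: "verts G = {..<card (verts G)}"
    by (auto simp: instance_graphs_def)
  let ?xs = "tuples d (card (verts G))"
  have ne: "set x \<noteq> {}" if "obstr G (set x)" for x
    using that by (auto simp: obstruction_def connected_graph_def)
  show "deletion_set \<Pi>\<^sub>1 \<Pi>\<^sub>2 G (approx_set G)"
    unfolding deletion_set_tuples[OF sG]
  proof (intro conjI allI impI)
    show "approx_set G \<subseteq> verts G" using approx_set_subset by (subst vG)
    show "set x \<inter> approx_set G \<noteq> {}" if "length x = d \<and> obstr G (set x)" for x
      unfolding approx_set_def approx_tuples_def
      by (rule packing_hits) (use that ne[of x] obstr_tuples[OF G, of x] in simp_all)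
  qed
  let ?F = "{S. deletion_set \<Pi>\<^sub>1 \<Pi>\<^sub>2 G S}"
  have "?F \<subseteq> Pow (verts G)" by (auto simp: deletion_set_def)
  then have "finite ?F" using sG by (auto simp: simple_graph_def intro: finite_subset)
  moreover have "set x \<inter> verts G \<noteq> {}" if "obstr G (set x)" for x
    using ne[OF that] that by (simp add: obstruction_def Int_absorb2)
  \<comment> \<open>Deleting every vertex is feasible, so the minimum is taken over a nonempty set
    and is attained.\<close>
  then have "verts G \<in> ?F"
    unfolding mem_Collect_eq deletion_set_tuples[OF sG] by simp
  ultimately have "Min (card ` ?F) \<in> card ` ?F" by (intro Min_in) auto
  then obtain S where S: "deletion_set \<Pi>\<^sub>1 \<Pi>\<^sub>2 G S" "Min (card ` ?F) = card S" by auto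
  have "finite S" using S(1) sG finite_subset by (auto simp: deletion_set_def simple_graph_def)
  then have "length (approx_tuples G) \<le> card S"
    unfolding approx_tuples_def using S(1)
    by (intro packing_length_le) (auto simp: deletion_set_tuples[OF sG] set_n_lists)
  moreover have "card (approx_set G) \<le> d * length (approx_tuples G)"
    unfolding approx_set_def approx_tuples_def
    by (intro card_Union_tuples) (use set_greedy in \<open>fastforce simp: set_n_lists\<close>)
  ultimately show "card (approx_set G) \<le> d * Min (card ` ?F)"
    unfolding S(2) by (meson le_trans mult_le_mono2)
qed

section \<open>The kernel\<close>

definition kernel_tuples :: "graph \<Rightarrow> nat \<Rightarrow> nat list list" where
  "kernel_tuples G k = greedy (kernel_step d k (\<lambda>x. obstr G (set x))) (tuples d (card (verts G)))"

definition kernel_vertices :: "graph \<Rightarrow> nat \<Rightarrow> nat list" where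
  "kernel_vertices G k = filter (\<lambda>v. v \<in> \<Union> (set ` set (kernel_tuples G k))) [0..<card (verts G)]"

definition kernel :: "graph \<times> nat \<Rightarrow> graph \<times> nat" where
  "kernel = (\<lambda>(G, k). (kernel_graph G (kernel_vertices G k), k))"

text \<open>Arithmetic is replaced by comparing list lengths. The alphabet consists of one
  \<open>Leaf\<close> and \<open>d\<close> copies of the \<open>k\<close> cells of the unary
  parameter, so the lists of length \<open>d - card I\<close> over it number
  \<open>(d * k + 1) ^ (d - card I)\<close>. Their number is polynomial because \<open>d\<close> is
  fixed and \<open>k\<close> is unary.\<close>

definition kernel_tree_step :: "tree \<Rightarrow> tree \<Rightarrow> tree list \<Rightarrow> bool" where
  "kernel_tree_step x t ts \<longleftrightarrow> obstr_tree (left x) t \<and>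
     (\<forall>I\<in>Pow {..<d}. length (filter (\<lambda>s. \<forall>i\<in>I. nth_tree s i = nth_tree t i) ts) <
       length (List.n_lists (d - card I) (Leaf # concat (replicate d (elems (right x))))))"

lemma ptime_kernel_tree_step:
  "ptime (\<lambda>z. enc_bool (kernel_tree_step (left z) (left (right z)) (elems (right (right z)))))"
  unfolding kernel_tree_step_def
proof (intro ptime_conj ptime_finite_ball)
  show "ptime (\<lambda>z. enc_bool (obstr_tree (left (left z)) (left (right z))))"
    by (intro ptime_obstr_tree ptime_left ptime_right ptime_id)
  fix I assume "I \<in> Pow {..<d}"
  then have "finite I" using finite_subset by auto
  show "ptime (\<lambda>z. enc_bool (length (filter (\<lambda>s. \<forall>i\<in>I. nth_tree s i = nth_tree (left (right z)) i) (elems (right (right z))))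
     < length (List.n_lists (d - card I) (Leaf # concat (replicate d (elems (right (left z))))))))"
  proof -
    have 1: "ptime (\<lambda>z. enc (filter (\<lambda>s. \<forall>i\<in>I. nth_tree s i = nth_tree (left (right z)) i) (elems (right (right z)))))"
      unfolding nth_tree_def
      by (rule ptime_filter)
        (intro ptime_finite_ball \<open>finite I\<close> ptime_equal ptime_nth ptime_left ptime_right ptime_id ptime_elems)+
    have "ptime (\<lambda>z. enc (concat (replicate n (elems (right (left z))))))" for n
      by (induction n) (auto intro!: ptime_append[unfolded enc_elems] ptime_Leaf ptime_append ptime_elems ptime_left ptime_right ptime_id simp del: enc_elems)
    then have "ptime (\<lambda>z. enc_list enc (List.n_lists (d - card I) (Leaf # concat (replicate d (elems (right (left z)))))))"
      by (intro ptime_n_lists ptime_Cons ptime_Leaf)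
    then have 2: "ptime (\<lambda>z. enc (map enc (List.n_lists (d - card I) (Leaf # concat (replicate d (elems (right (left z))))))))"
      by (simp add: enc_map)
    from ptime_length_less[OF 1 2] show ?thesis by simp
  qed
qed simp

lemma kernel_tuples_tree:
  assumes "G \<in> instance_graphs"
  shows "greedy (kernel_tree_step (enc_instance (G, k))) (tuple_trees d (enc_graph G)) =
    map (enc_list enc_nat) (kernel_tuples G k)"
  unfolding kernel_tuples_def tuple_trees_eq len_enc_graph
proof (rule greedy_map)
  fix x ys assume x: "x \<in> set (tuples d (card (verts G)))" and ys: "set ys \<subseteq> set (tuples d (card (verts G)))"
  have len: "length y = d" if "y \<in> set (tuples d (card (verts G)))" for y
    using that by (auto simp: set_n_lists)
  have cnt: "length (filter (\<lambda>s. \<forall>i\<in>I. nth_tree s i = nth_tree (enc_list enc_nat x) i) (map (enc_list enc_nat) ys)) =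
      length (filter (agree I x) ys)" if "I \<in> Pow {..<d}" for I
  proof -
    have "(\<forall>i\<in>I. nth_tree (enc_list enc_nat y) i = nth_tree (enc_list enc_nat x) i) \<longleftrightarrow> agree I x y"
      if "y \<in> set ys" for y
      unfolding agree_def
      using \<open>I \<in> Pow {..<d}\<close> len[OF x] len[OF subsetD[OF ys that]] by (intro ball_cong refl) (auto simp: nth_tree_enc)
    then have "filter (\<lambda>y. \<forall>i\<in>I. nth_tree (enc_list enc_nat y) i = nth_tree (enc_list enc_nat x) i) ys =
        filter (agree I x) ys"
      by (rule filter_cong[OF refl])
    then show ?thesis unfolding filter_map length_map comp_def by (rule arg_cong)
  qed
  have bound: "length (List.n_lists m (Leaf # concat (replicate d (elems (right (enc_instance (G, k))))))) = (d * k + 1) ^ m" for m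
    by (simp add: length_n_lists length_concat sum_list_replicate)
  show "kernel_tree_step (enc_instance (G, k)) (enc_list enc_nat x) (map (enc_list enc_nat) ys) =
      kernel_step d k (\<lambda>x. obstr G (set x)) x ys"
    unfolding kernel_tree_step_def kernel_step_def bound enc_instance.simps left.simps obstr_tree_enc[OF assms x]
    by (intro conj_cong ball_cong refl) (simp only: cnt bound[unfolded enc_instance.simps])
qed

lemma polytime_kernel: "polytime_computable (instance_graphs \<times> UNIV) enc_instance enc_instance kernel"
proof (rule ptime_imp_polytime_computable)
  define V where "V x = covered_vertices (left x) (greedy (kernel_tree_step x) (tuple_trees d (left x)))" for x
  have V: "ptime (\<lambda>x. enc (V x))"
    unfolding V_def
    by (intro ptime_covered_vertices ptime_greedy ptime_kernel_tree_step ptime_tuple_trees ptime_left ptime_id)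
  \<comment> \<open>This is one row of the matrix. Its context is a pair of the instance and the row
    vertex, which the outer map supplies.\<close>
  have "ptime (\<lambda>x. enc (map (\<lambda>v. adj_tree (left (left x)) (right x) v) (V (left x))))"
    by (rule ptime_map[OF _ ptime_subst[OF V]])
      (intro ptime_adj_tree ptime_left ptime_right ptime_id)+
  then have "ptime (\<lambda>x. enc (map (\<lambda>u. enc (map (\<lambda>v. adj_tree (left x) u v) (V x))) (V x)))"
    by (rule ptime_map[OF _ V])
  then show "ptime (\<lambda>x. Node (enc (map (\<lambda>u. enc (map (\<lambda>v. adj_tree (left x) u v) (V x))) (V x))) (right x))"
    by (intro ptime_Node ptime_right ptime_id)
  fix x assume "x \<in> instance_graphs \<times> (UNIV :: nat set)"
  then obtain G k where x: "x = (G, k)" and G: "G \<in> instance_graphs" by auto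
  have V: "V (enc_instance x) = map enc_nat (kernel_vertices G k)"
    unfolding V_def x using kernel_tuples_tree[OF G, of k]
    by (simp add: covered_vertices_enc kernel_vertices_def)
  have "v < card (verts G)" if "v \<in> set (kernel_vertices G k)" for v
    using that by (simp add: kernel_vertices_def)
  then have "enc (map (\<lambda>u. enc (map (\<lambda>v. adj_tree (enc_graph G) u v) (V (enc_instance x)))) (V (enc_instance x)))
    = enc_graph (kernel_graph G (kernel_vertices G k))"
    unfolding V enc_kernel_graph enc_map[of "enc_list enc_bool", symmetric] enc_map[of enc_bool, symmetric]
    by (simp add: adj_tree_enc comp_def cong: map_cong)
  then show "Node (enc (map (\<lambda>u. enc (map (\<lambda>v. adj_tree (left (enc_instance x)) u v) (V (enc_instance x)))) (V (enc_instance x)))) (right (enc_instance x))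
    = enc_instance (kernel x)"
    by (simp add: x kernel_def)
qed

text \<open>An obstruction of the kernel embeds into \<open>G\<close>, so restricting a solution of
  \<open>G\<close> to the kept vertices solves the kernel. Conversely, every kept tuple is an
  obstruction of the kernel and hence hit by a solution there; \<open>kernel_hits\<close> extends
  this to all tuples.\<close>

lemma kernel_equivalent:
  assumes G: "G \<in> instance_graphs"
  shows "deletion_problem \<Pi>\<^sub>1 \<Pi>\<^sub>2 G k \<longleftrightarrow> deletion_problem \<Pi>\<^sub>1 \<Pi>\<^sub>2 (kernel_graph G (kernel_vertices G k)) k"
proof -
  define vs where "vs = kernel_vertices G k"
  define H where "H = kernel_graph G vs"
  have sG: "simple_graph G" and vG: "verts G = {..<card (verts G)}"
    using G by (auto simp: instance_graphs_def)
  have sH: "simple_graph H" unfolding H_def using sG by (rule simple_kernel_graph)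
  have vs: "distinct vs" "set vs \<subseteq> verts G"
    using vG by (auto simp: vs_def kernel_vertices_def)
  have inj: "inj_on ((!) vs) {..<length vs}" using vs(1) by (simp add: inj_on_nth)
  have nthG: "vs ! i \<in> verts G" if "i < length vs" for i
    using vs(2) that by (meson nth_mem subsetD)
  have tup: "set x \<subseteq> set vs" "obstr G (set x)" if "x \<in> set (kernel_tuples G k)" for x
  proof -
    have "x \<in> set (tuples d (card (verts G)))"
      using subsetD[OF set_greedy] that unfolding kernel_tuples_def .
    then have "set x \<subseteq> {..<card (verts G)}" by (auto simp: set_n_lists)
    then show "set x \<subseteq> set vs"
      using that unfolding vs_def kernel_vertices_def by fastforce
    have "\<forall>x\<in>set (kernel_tuples G k). obstr G (set x)"
      unfolding kernel_tuples_def by (induction rule: greedy_induct) (simp_all add: kernel_step_def)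
    then show "obstr G (set x)" using that by blast
  qed
  have "deletion_problem \<Pi>\<^sub>1 \<Pi>\<^sub>2 H k" if "deletion_set \<Pi>\<^sub>1 \<Pi>\<^sub>2 G S" "card S \<le> k" for S
  proof -
    let ?S = "{i. i < length vs \<and> vs ! i \<in> S}"
    have S: "S \<subseteq> verts G" "\<And>W. obstr G W \<Longrightarrow> W \<inter> S \<noteq> {}"
      using that(1) unfolding deletion_set_iff[OF sG her] by auto
    have "finite S" using S(1) sG finite_subset by (auto simp: simple_graph_def)
    have "deletion_set \<Pi>\<^sub>1 \<Pi>\<^sub>2 H ?S"
      unfolding deletion_set_iff[OF sH her]
    proof (intro conjI allI impI)
      fix W assume W: "obstr H W"
      then have WH: "W \<subseteq> {..<length vs}" by (auto simp: obstruction_def H_def)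
      have "obstr G ((!) vs ` W)"
        by (rule obstruction_transfer[OF closed sH sG inj_on_subset[OF inj WH] _ _ W])
          (use WH nthG in \<open>auto simp: H_def\<close>)
      then show "W \<inter> ?S \<noteq> {}" using S(2) WH by blast
    qed (auto simp: H_def)
    moreover have "card ?S \<le> card S"
      using \<open>finite S\<close> by (intro card_inj_on_le[of "(!) vs"] inj_on_subset[OF inj]) auto
    ultimately show ?thesis unfolding deletion_problem_def using that(2) by (meson le_trans)
  qed
  moreover have "deletion_problem \<Pi>\<^sub>1 \<Pi>\<^sub>2 G k" if S: "deletion_set \<Pi>\<^sub>1 \<Pi>\<^sub>2 H S" "card S \<le> k" for S
  proof -
    have SH: "S \<subseteq> {..<length vs}" "\<And>W. obstr H W \<Longrightarrow> W \<inter> S \<noteq> {}"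
      using S(1) unfolding deletion_set_iff[OF sH her] by (auto simp: H_def)
    have "finite S" using SH(1) finite_subset by blast
    let ?S = "(!) vs ` S" and ?g = "inv_into {..<length vs} ((!) vs)"
    have img: "(!) vs ` {..<length vs} = set vs" by (auto simp: set_conv_nth)
    have g: "?g v < length vs" "vs ! ?g v = v" if "v \<in> set vs" for v
      using that inv_into_into[of v "(!) vs" "{..<length vs}"] f_inv_into_f[of v "(!) vs" "{..<length vs}"]
      unfolding img by auto
    have card: "card ?S \<le> k" using card_image_le[OF \<open>finite S\<close>, of "(!) vs"] S(2) by linarith
    have hit: "set x \<inter> ?S \<noteq> {}" if x: "x \<in> set (kernel_tuples G k)" for x
    proof -
      have "obstr H (?g ` set x)"
        by (rule obstruction_transfer[OF closed sG sH _ _ _ tup(2)[OF x]])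
          (use g tup(1)[OF x] in \<open>auto simp: H_def inj_on_def subset_eq\<close>, metis)
      then obtain v where "v \<in> set x" "?g v \<in> S" using SH(2) by blast
      then have "v \<in> ?S" using g(2)[of v] tup(1)[OF x] by (metis imageI subsetD)
      then show ?thesis using \<open>v \<in> set x\<close> by blast
    qed
    have "deletion_set \<Pi>\<^sub>1 \<Pi>\<^sub>2 G ?S"
      unfolding deletion_set_tuples[OF sG]
    proof (intro conjI allI impI)
      show "?S \<subseteq> verts G" using SH(1) nthG by auto
      fix x assume x: "length x = d \<and> obstr G (set x)"
      show "set x \<inter> ?S \<noteq> {}"
      proof (rule kernel_hits[of ?S k d "\<lambda>x. obstr G (set x)" "tuples d (card (verts G))"])
        show "x \<in> set (tuples d (card (verts G)))" using obstr_tuples[OF G] x by blast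
      qed (use \<open>finite S\<close> card hit x in \<open>auto simp: kernel_tuples_def set_n_lists\<close>)
    qed
    then show ?thesis unfolding deletion_problem_def using card by blast
  qed
  ultimately have "deletion_problem \<Pi>\<^sub>1 \<Pi>\<^sub>2 G k \<longleftrightarrow> deletion_problem \<Pi>\<^sub>1 \<Pi>\<^sub>2 H k"
    unfolding deletion_problem_def by blast
  then show ?thesis unfolding H_def vs_def .
qed

text \<open>All tuples agree on the empty set of positions, so \<open>kernel_agree_le\<close> bounds
  the total number of kept tuples; each contributes at most \<open>d\<close> vertices.\<close>

lemma length_kernel_vertices: "length (kernel_vertices G k) \<le> d * (d * k + 1) ^ d"
proof -
  have "length (kernel_vertices G k) = card (set (kernel_vertices G k))"
    by (rule distinct_card[symmetric]) (simp add: kernel_vertices_def)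
  also have "\<dots> \<le> card (\<Union> (set ` set (kernel_tuples G k)))"
    by (intro card_mono) (auto simp: kernel_vertices_def)
  also have "\<dots> \<le> d * length (kernel_tuples G k)"
    unfolding kernel_tuples_def
    by (intro card_Union_tuples) (use set_greedy in \<open>fastforce simp: set_n_lists\<close>)
  also have "length (kernel_tuples G k) \<le> (d * k + 1) ^ d"
    using kernel_agree_le[of "{}" d] by (simp add: agree_def kernel_tuples_def)
  finally show ?thesis by simp
qed

lemma kernelization: "kernelization (deletion_problem \<Pi>\<^sub>1 \<Pi>\<^sub>2) kernel"
  unfolding kernelization_def
proof (intro conjI polytime_kernel exI ballI allI impI)
  fix G k G' k'
  assume G: "G \<in> instance_graphs" and "kernel (G, k) = (G', k')"
  then have K: "G' = kernel_graph G (kernel_vertices G k)" "k' = k" by (auto simp: kernel_def)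
  define b where "b = d * (d * k + 1) ^ d"
  have len: "length (kernel_vertices G k) \<le> b" unfolding b_def by (rule length_kernel_vertices)
  show "G' \<in> instance_graphs"
    using G unfolding K by (auto simp: instance_graphs_def intro: kernel_graph_instance[unfolded instance_graphs_def, simplified])
  show "deletion_problem \<Pi>\<^sub>1 \<Pi>\<^sub>2 G k \<longleftrightarrow> deletion_problem \<Pi>\<^sub>1 \<Pi>\<^sub>2 G' k'"
    unfolding K using kernel_equivalent[OF G] .
  \<comment> \<open>This choice instantiates the size function left open by \<open>exI\<close>:
    \<open>k\<close> for the parameter, \<open>b\<close> for the vertices and \<open>b * b\<close>
    for the ordered pairs that store the edges.\<close>
  show "k' \<le> k + d * (d * k + 1) ^ d + d * (d * k + 1) ^ d * (d * (d * k + 1) ^ d)"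
    by (simp add: K)
  show "card (verts G') + card (edges G') \<le> k + d * (d * k + 1) ^ d + d * (d * k + 1) ^ d * (d * (d * k + 1) ^ d)"
    unfolding b_def[symmetric] K
    using len card_edges_kernel_graph[of G "kernel_vertices G k"] mult_le_mono[OF len len] by simp
qed

lemma kernel_bound_bigo: "(\<lambda>k. real (d * (d * k + 1) ^ d)) \<in> O(\<lambda>k. real k ^ d)"
proof (rule bigoI)
  \<comment> \<open>For \<open>k\<close> at least 1, \<open>d * k + 1\<close> is at most
    \<open>(d + 1) * k\<close>, which gives the constant \<open>d * (d + 1) ^ d\<close>.\<close>
  show "\<forall>\<^sub>F k in at_top. norm (real (d * (d * k + 1) ^ d)) \<le> real (d * (d + 1) ^ d) * norm (real k ^ d)"
    using eventually_ge_at_top[of 1]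
  proof eventually_elim
    case (elim k)
    have "(d * k + 1) ^ d \<le> ((d + 1) * k) ^ d" using elim by (intro power_mono) auto
    then have "d * (d * k + 1) ^ d \<le> d * (d + 1) ^ d * k ^ d"
      unfolding power_mult_distrib mult.assoc by (rule mult_le_mono2)
    then have "real (d * (d * k + 1) ^ d) \<le> real (d * (d + 1) ^ d * k ^ d)"
      by (simp only: of_nat_le_iff)
    then show ?case by simp
  qed
qed

end

theorem theorem2:
  fixes \<Pi>\<^sub>1 \<Pi>\<^sub>2 \<F>\<^sub>1 \<F>\<^sub>2 :: "graph set" and \<alpha> d\<^sub>1 d\<^sub>2 d :: nat
  assumes "graph_class \<Pi>\<^sub>1" and "hereditary \<Pi>\<^sub>1"
    and "graph_class \<Pi>\<^sub>2" and "hereditary \<Pi>\<^sub>2"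
    and "forbidden_family \<Pi>\<^sub>1 \<F>\<^sub>1" and "forbidden_family \<Pi>\<^sub>2 \<F>\<^sub>2"
    and "\<forall>H\<in>\<F>\<^sub>1 \<union> \<F>\<^sub>2. connected_graph H"
    and "finite \<F>\<^sub>1" and "finite \<F>\<^sub>2"
    and "\<exists>H\<in>\<F>\<^sub>1. isomorphic H (path_graph \<alpha>)"
    and "d\<^sub>1 = max_order \<F>\<^sub>1" and "d\<^sub>2 = max_order \<F>\<^sub>2"
    and "d = d\<^sub>1 + d\<^sub>2 + \<alpha> - 2"
  shows "(\<exists>A. approximation_algorithm (deletion_set \<Pi>\<^sub>1 \<Pi>\<^sub>2) d A) \<and>
         (\<exists>K. kernelization (deletion_problem \<Pi>\<^sub>1 \<Pi>\<^sub>2) K \<and>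
              (\<exists>g :: nat \<Rightarrow> real. g \<in> O(\<lambda>k. real k ^ d) \<and>
                 (\<forall>G\<in>instance_graphs. \<forall>k. real (card (verts (fst (K (G, k))))) \<le> g k)))"
proof -
  interpret scattered_pair \<Pi>\<^sub>1 \<Pi>\<^sub>2 \<F>\<^sub>1 \<F>\<^sub>2 \<alpha> d
    using assms by unfold_locales auto
  have "real (card (verts (fst (kernel (G, k))))) \<le> real (d * (d * k + 1) ^ d)" for G k
    using length_kernel_vertices[of G k]
    by (simp only: of_nat_le_iff kernel_def prod.case fst_conv kernel_graph_simps card_lessThan)
  then show ?thesis
    using approximation kernelization kernel_bound_bigo by blast
qed

end
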